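(* Let $T$ be an ergodic measure preserving transformation on a non-atomic probability measure space $(X,\mathcal{B},\mu)$. Then there exist functions $f,g\in L^1(X,\mathcal{B},\mu)$ for which the Furstenberg averages $$\frac{1}{N}\sum_{n=0}^{N} f(T^nx)\,g(T^{2n}x)$$ do not converge $\mu$-almost everywhere as $N\to\infty$.
   Context: "Do not converge $\mu$-almost everywhere" means that it is false that for $\mu$-a.e. $x$ the averages converge to a finite limit as $N\to\infty$. *)

theory Defs
  imports "HOL-Probability.Probability"
begin

definition measure_atom :: "'a measure \<Rightarrow> 'a set \<Rightarrow> bool" where
  "measure_atom M A \<longleftrightarrow> A \<in> sets M \<and> emeasure M A > 0 \<and>
     (\<forall>B \<in> sets M. B \<subseteq> A \<and> emeasure M B < emeasure M A \<longrightarrow> emeasure M B = 0)"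

definition nonatomic :: "'a measure \<Rightarrow> bool" where
  "nonatomic M \<longleftrightarrow> (\<nexists>A. measure_atom M A)"

definition measure_preserving :: "'a measure \<Rightarrow> ('a \<Rightarrow> 'a) \<Rightarrow> bool" where
  "measure_preserving M T \<longleftrightarrow> T \<in> measurable M M \<and>
     (\<forall>A \<in> sets M. emeasure M (T -` A \<inter> space M) = emeasure M A)"

definition ergodic :: "'a measure \<Rightarrow> ('a \<Rightarrow> 'a) \<Rightarrow> bool" where
  "ergodic M T \<longleftrightarrow>
     (\<forall>A \<in> sets M. T -` A \<inter> space M = A \<longrightarrow>
        emeasure M A = 0 \<or> emeasure M (space M - A) = 0)"

(* The sum has N + 1 terms (n = 0, ..., N) but the normalisation is 1 / N.
   At N = 0 the value is 0, since 1 / 0 = 0; this does not affect the limit. *)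
definition furstenberg_average ::
    "('a \<Rightarrow> 'a) \<Rightarrow> ('a \<Rightarrow> real) \<Rightarrow> ('a \<Rightarrow> real) \<Rightarrow> nat \<Rightarrow> 'a \<Rightarrow> real" where
  "furstenberg_average T f g N x =
     1 / real N * (\<Sum>n = 0..N. f ((T ^^ n) x) * g ((T ^^ (2 * n)) x))"

end

theory Submission
  imports Defs
begin

text \<open>Convergent averages are bounded, and for nonnegative \<open>f\<close>, \<open>g\<close> the \<open>n\<close>-th average is at
least \<open>f (T\<^sup>n x) g (T\<^sup>2\<^sup>n x) / n\<close>. So the divergence follows once this single term is
unbounded in \<open>n\<close> for all \<open>x\<close> in a set of positive measure.

An ergodic system without atoms contains arbitrarily high towers (\<open>tower\<close>). Copying a pattern
\<open>F, G\<close> on \<open>{0..<N}\<close> onto a tower of height \<open>N\<close> reduces the problem to the integers. Call \<open>t\<close> hit if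
\<open>n \<le> F (t + n) * G (t + 2 * n)\<close> for some \<open>n \<ge> 1\<close>. It suffices to find, for every \<open>e > 0\<close>, patterns of
mean at most a constant times \<open>e\<close> that hit a proportion of the positions bounded below
independently of \<open>e\<close> (\<open>exists_pattern\<close>). With \<open>e = 4 ^ (-k)\<close>, the functions obtained from the
\<open>k\<close>-th pattern may be multiplied by \<open>2 ^ k\<close> and summed over \<open>k\<close>, and the points that
lie in infinitely many of the hit sets form a set of positive measure.

Independent random spikes do not achieve this. If \<open>F\<close> and \<open>G\<close> are independent and stationary with mean \<open>e\<close>, the
expected number of \<open>n\<close> with \<open>n \<le> F (t + n) * G (t + 2 * n)\<close> is at most \<open>e\<^sup>2\<close>, and adding
several such layers costs more mean than it hits. The way out is to use the same mass at many
scales. There are two ways to dilate a pair \<open>(F, G)\<close> by a factor \<open>l\<close> without changing its means or its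
probability of hits: concentrate \<open>F\<close> on spikes that are \<open>l\<close> times as high and \<open>l\<close> times as rare
while \<open>G\<close> is merely stretched, or do the same with the roles exchanged (\<open>hits_spike_F\<close>,
\<open>hits_spike_G\<close>). Cut the integers into long blocks, put an independent copy of the pair into each of
them, and let a fair coin decide for each block which dilation is used. Inside the blocks the old
hits survive. In addition, the \<open>F\<close>-spikes of some blocks meet the \<open>G\<close>-spikes of others; here the expected
number of successful \<open>n\<close> is about \<open>(e / 2)\<^sup>2\<close>, and as repeated successes are rare, a new hit occurs with
probability at least \<open>e\<^sup>2 / 8\<close> (\<open>meet_some_prob\<close>). It depends on other blocks than the one
containing \<open>t\<close>, so it is independent of the old hits at \<open>t\<close>. Each round thus multiplies the probability of not being
hit by about \<open>1 - e\<^sup>2 / 8\<close> and leaves the means alone (\<open>joined_process\<close>), and finitely many rounds bring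
the hit probability up to \<open>1 / 2\<close> (\<open>attains_half\<close>).\<close>

section \<open>Finite probability\<close>

lemma prob_pair_pmf_Times:
  "measure_pmf.prob (pair_pmf p q) (A \<times> B) = measure_pmf.prob p A * measure_pmf.prob q B"
proof -
  have "emeasure (pair_pmf p q) (A \<times> B) = (\<integral>\<^sup>+x. \<integral>\<^sup>+y. indicator (A \<times> B) (x, y) \<partial>q \<partial>p)"
    by (subst nn_integral_pair_pmf'[symmetric]) simp
  also have "\<dots> = (\<integral>\<^sup>+x. indicator A x * emeasure q B \<partial>p)"
    by (simp add: indicator_times nn_integral_cmult)
  also have "\<dots> = emeasure p A * emeasure q B"
    by (simp add: nn_integral_multc)
  finally have "ennreal (measure_pmf.prob (pair_pmf p q) (A \<times> B)) = 
    ennreal (measure_pmf.prob p A * measure_pmf.prob q B)"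
    by (simp add: measure_pmf.emeasure_eq_measure ennreal_mult')
  thus ?thesis by simp
qed

lemma prob_bind_pmf_ge:
  assumes "\<And>y. y \<in> set_pmf r \<inter> G \<Longrightarrow> \<theta> \<le> measure_pmf.prob (f y) A" and "0 \<le> \<theta>"
  shows "measure_pmf.prob r G * \<theta> \<le> measure_pmf.prob (bind_pmf r f) A"
proof -
  have "ennreal (measure_pmf.prob r G * \<theta>) = (\<integral>\<^sup>+y. ennreal \<theta> * indicator G y \<partial>r)"
    using assms(2)
    by (simp add: nn_integral_cmult measure_pmf.emeasure_eq_measure ennreal_mult'' mult.commute)
  also have "\<dots> \<le> (\<integral>\<^sup>+y. emeasure (f y) A \<partial>r)"
    using assms
    by (intro nn_integral_mono_AE)
       (auto simp: AE_measure_pmf_iff measure_pmf.emeasure_eq_measure indicator_def ennreal_leI)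
  also have "\<dots> = ennreal (measure_pmf.prob (bind_pmf r f) A)"
    by (simp flip: measure_pmf.emeasure_eq_measure)
  finally show ?thesis by (simp add: measure_nonneg)
qed

lemma pair_pmf_eq_bind: "pair_pmf r s = bind_pmf r (\<lambda>y. map_pmf (Pair y) s)"
  by (simp add: pair_pmf_def map_pmf_def)

lemma prob_pair_pmf_ge:
  assumes "\<And>y. y \<in> set_pmf r \<inter> G \<Longrightarrow> \<theta> \<le> measure_pmf.prob s {z. P (y, z)}" and "0 \<le> \<theta>"
  shows "measure_pmf.prob r G * \<theta> \<le> measure_pmf.prob (pair_pmf r s) {w. P w}"
  unfolding pair_pmf_eq_bind using assms
  by (intro prob_bind_pmf_ge) (auto simp: vimage_def)

lemma pair_map_map:
  "map_pmf (\<lambda>z. (f (fst z), g (snd z))) (pair_pmf p q) = pair_pmf (map_pmf f p) (map_pmf g q)"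
  using map_pair[of f g p q] by (simp add: case_prod_beta')

text \<open>Events that are governed by disjoint sets of coordinates of a product are independent. All
independence used below, between blocks and between pairs of blocks, is an instance.\<close>

lemma Pi_pmf_indep:
  fixes p :: "'i \<Rightarrow> 'b pmf"
  assumes "finite A" "I \<subseteq> A"
    and f: "\<And>\<omega> \<omega>'. (\<And>i. i \<in> I \<Longrightarrow> \<omega> i = \<omega>' i) \<Longrightarrow> f \<omega> = f \<omega>'"
    and g: "\<And>\<omega> \<omega>'. (\<And>i. i \<in> A - I \<Longrightarrow> \<omega> i = \<omega>' i) \<Longrightarrow> g \<omega> = g \<omega>'"
  shows "map_pmf (\<lambda>\<omega>. (f \<omega>, g \<omega>)) (Pi_pmf A d p) =
    pair_pmf (map_pmf f (Pi_pmf A d p)) (map_pmf g (Pi_pmf A d p))"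
proof -
  let ?I = "Pi_pmf I d p" and ?J = "Pi_pmf (A - I) d p"
  let ?h = "\<lambda>w x. if x \<in> I then fst w x else snd w x"
  have fin: "finite I" "finite (A - I)" using assms finite_subset by auto
  have A: "A = I \<union> (A - I)" using assms by auto
  have eq: "Pi_pmf A d p = map_pmf ?h (pair_pmf ?I ?J)"
    by (subst A, subst Pi_pmf_union) (use fin in \<open>auto simp: case_prod_beta'\<close>)
  have F: "f (?h w) = f (fst w)" for w by (rule f) auto
  have G: "g (?h w) = g (snd w)" for w by (rule g) auto
  have mf: "map_pmf f (Pi_pmf A d p) = map_pmf f ?I"
    unfolding eq map_pmf_comp F by (simp add: map_fst_pair_pmf flip: map_pmf_comp)
  have mg: "map_pmf g (Pi_pmf A d p) = map_pmf g ?J"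
    unfolding eq map_pmf_comp G by (simp add: map_snd_pair_pmf flip: map_pmf_comp)
  show ?thesis
    unfolding mf mg unfolding eq map_pmf_comp F G by (rule pair_map_map)
qed

lemma prob_Pi_pmf_indep:
  assumes "finite A" "I \<subseteq> A"
    and "\<And>\<omega> \<omega>'. (\<And>i. i \<in> I \<Longrightarrow> \<omega> i = \<omega>' i) \<Longrightarrow> f \<omega> = f \<omega>'"
    and "\<And>\<omega> \<omega>'. (\<And>i. i \<in> A - I \<Longrightarrow> \<omega> i = \<omega>' i) \<Longrightarrow> g \<omega> = g \<omega>'"
  shows "measure_pmf.prob (Pi_pmf A d p) {\<omega>. f \<omega> \<and> g \<omega>} =
    measure_pmf.prob (Pi_pmf A d p) {\<omega>. f \<omega>} * measure_pmf.prob (Pi_pmf A d p) {\<omega>. g \<omega>}"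
proof -
  have "measure_pmf.prob (Pi_pmf A d p) {\<omega>. f \<omega> \<and> g \<omega>} =
    measure_pmf.prob (map_pmf (\<lambda>\<omega>. (f \<omega>, g \<omega>)) (Pi_pmf A d p)) ({True} \<times> {True})"
    by (simp add: vimage_def)
  also have "\<dots> = measure_pmf.prob (map_pmf f (Pi_pmf A d p)) {True} *
      measure_pmf.prob (map_pmf g (Pi_pmf A d p)) {True}"
    by (subst Pi_pmf_indep[OF assms]) (simp_all only: prob_pair_pmf_Times)
  finally show ?thesis by (simp add: vimage_def)
qed

lemma (in prob_space) bonferroni_lower:
  fixes E :: "nat \<Rightarrow> 'a set"
  assumes "\<And>j. j < m \<Longrightarrow> E j \<in> events"
  shows "(\<Sum>j<m. prob (E j)) - (\<Sum>j<m. \<Sum>i<j. prob (E i \<inter> E j)) \<le> prob (\<Union>j<m. E j)"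
  using assms
proof (induction m)
  case (Suc m)
  let ?U = "\<Union>j<m. E j"
  have U: "?U \<in> events" using Suc.prems by auto
  have "prob (?U \<inter> E m) = prob (\<Union>i<m. E i \<inter> E m)" by (rule arg_cong[where f=prob]) auto
  also have "\<dots> \<le> (\<Sum>i<m. prob (E i \<inter> E m))"
    using Suc.prems by (intro finite_measure_subadditive_finite) auto
  finally have 1: "prob (?U \<inter> E m) \<le> (\<Sum>i<m. prob (E i \<inter> E m))" .
  have "prob (?U \<union> E m) = prob ?U + prob (E m) - prob (?U \<inter> E m)"
    using U Suc.prems by (intro measure_Un3) (auto simp: fmeasurable_eq_sets)
  moreover have "(\<Union>j<Suc m. E j) = ?U \<union> E m" by (auto simp: lessThan_Suc)
  ultimately show ?case using 1 Suc.IH Suc.prems by (simp add: lessThan_Suc)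
qed simp

text \<open>This identity turns a sum of probabilities over all lengths \<open>n\<close> into a mean, so that the
expected number of new hits depends only on the means of the two factors.\<close>

lemma layer_cake_pmf:
  fixes f :: "'a \<Rightarrow> nat"
  assumes "\<And>x. x \<in> set_pmf p \<Longrightarrow> f x < m"
  shows "measure_pmf.expectation p (\<lambda>x. real (f x)) =
    (\<Sum>n\<in>{1..<m}. measure_pmf.prob p {x. n \<le> f x})"
proof -
  have "measure_pmf.expectation p (\<lambda>x. real (f x)) =
     measure_pmf.expectation p (\<lambda>x. \<Sum>n\<in>{1..<m}. indicator {x. n \<le> f x} x)"
  proof (intro integral_cong_AE, goal_cases)
    case 3
    have "real (f x) = (\<Sum>n\<in>{1..<m}. indicator {x. n \<le> f x} x)" if "x \<in> set_pmf p" for x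
    proof -
      have "(\<Sum>n\<in>{1..<m}. indicator {x. n \<le> f x} x :: real) = real (card {n\<in>{1..<m}. n \<le> f x})"
        by (simp add: indicator_def of_bool_def[symmetric] Int_def)
      also have "{n\<in>{1..<m}. n \<le> f x} = {1..f x}" using assms[OF that] by auto
      finally show ?thesis by simp
    qed
    thus ?case by (auto simp: AE_measure_pmf_iff)
  qed auto
  also have "\<dots> = (\<Sum>n\<in>{1..<m}. measure_pmf.prob p {x. n \<le> f x})"
    by (subst Bochner_Integration.integral_sum) (auto intro!: measure_pmf.integrable_const_bound[where B=1])
  finally show ?thesis .
qed

section \<open>Two dilations that preserve hits\<close>

definition hits :: "(nat \<Rightarrow> nat) \<Rightarrow> (nat \<Rightarrow> nat) \<Rightarrow> nat \<Rightarrow> nat \<Rightarrow> bool" where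
  "hits F G R t \<longleftrightarrow> (\<exists>n\<in>{1..R}. n \<le> F (t + n) * G (t + 2 * n))"

definition spike :: "nat \<Rightarrow> nat \<Rightarrow> (nat \<Rightarrow> nat) \<Rightarrow> nat \<Rightarrow> nat" where
  "spike l r F s = (if l dvd s + r then l * F ((s + r) div l) else 0)"

lemma spike_pos_imp_dvd: "0 < spike l r F s \<Longrightarrow> l dvd s + r"
  by (auto simp: spike_def split: if_splits)

text \<open>Every new position \<open>t\<close> inherits a hit from its cell \<open>(t + r) div l\<close>: an old hit of length \<open>m\<close> leads
to the spike of the cell \<open>m\<close> steps ahead, at a distance of at most \<open>l * m\<close>, and the spike is
\<open>l\<close> times as high as before. Rounding up in the argument of \<open>G\<close> makes \<open>t + 2 * n\<close> fall into the
right cell, since \<open>n\<close> may be slightly shorter than \<open>l * m\<close>.\<close>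

lemma hits_spike_F:
  assumes l: "0 < l" and hit: "hits F G R ((t + r) div l)"
  shows "hits (spike l r F) (\<lambda>s. G ((s + r + (l - 1)) div l)) (l * R) t"
proof -
  define x d where "x = (t + r) div l" and "d = (t + r) mod l"
  have tr: "t + r = l * x + d" and d: "d < l" using l by (auto simp: x_def d_def)
  obtain m where m: "1 \<le> m" "m \<le> R" "m \<le> F (x + m) * G (x + 2 * m)"
    using hit by (auto simp: hits_def x_def)
  define n where "n = l * m - d"
  have lm: "l \<le> l * m" using m by simp
  have ln: "l * m = n + d" using d lm unfolding n_def by linarith
  have n: "1 \<le> n" "n \<le> l * m" using d lm ln by linarith+
  have "t + n + r = l * (x + m)" using tr ln by (simp add: algebra_simps)
  hence F: "spike l r F (t + n) = l * F (x + m)" using l by (simp add: spike_def)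
  have "t + 2 * n + r + (l - 1) = l * (x + 2 * m) + (l - 1 - d)"
    using tr ln d by (simp add: algebra_simps)
  hence "(t + 2 * n + r + (l - 1)) div l = x + 2 * m" using l
    by simp
  moreover have "n \<le> l * (F (x + m) * G (x + 2 * m))"
    using n(2) mult_le_mono2[OF m(3), of l] by (rule le_trans)
  ultimately have "n \<le> spike l r F (t + n) * G ((t + 2 * n + r + (l - 1)) div l)"
    using F by (simp add: mult.assoc)
  moreover have "n \<le> l * R" using n m l by (meson le_trans mult_le_mono2)
  ultimately show ?thesis using n(1) by (auto simp: hits_def)
qed

text \<open>Now the position \<open>t + 2 * n\<close> must be a spike, and this fixes the parity of \<open>t\<close>. As \<open>l\<close> is odd, two
consecutive spikes have different parity, so \<open>t\<close> may be referred to its own cell or to the one before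
it, whichever fits. The condition \<open>l \<le> r\<close> guarantees that there is a cell before it.\<close>

lemma hits_spike_G:
  assumes l: "odd l" "l \<le> r"
  obtains x where "\<And>F G. hits F G R x \<Longrightarrow> hits (\<lambda>s. F ((s + r) div l)) (spike l r G) (l * R) t"
proof -
  have l0: "0 < l" using l by (auto intro: Nat.gr0I)
  obtain x e where tr: "t + r = l * x + 2 * e" and e: "e < l"
  proof (cases "even ((t + r) mod l)")
    case True
    then obtain e where "(t + r) mod l = 2 * e" by auto
    moreover from this have "e < l" using mod_less_divisor[OF l0, of "t + r"] by linarith
    ultimately show ?thesis using that[of "(t + r) div l" e] by (metis mult_div_mod_eq)
  next
    case False
    hence "even ((t + r) mod l + l)" using l by simp
    then obtain e where e: "(t + r) mod l + l = 2 * e" by (rule evenE)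
    have "e < l" using mod_less_divisor[OF l0, of "t + r"] e by linarith
    moreover have "1 \<le> (t + r) div l" using l l0 by (simp add: div_greater_zero_iff Suc_leI)
    then obtain y where y: "(t + r) div l = Suc y" by (metis Suc_le_D One_nat_def)
    have "t + r = l * Suc y + (t + r) mod l" unfolding y[symmetric] by simp
    hence "t + r = l * y + 2 * e" using e by simp
    ultimately show ?thesis using that by blast
  qed
  show ?thesis
  proof (rule that[of x])
    fix F G assume "hits F G R x"
    then obtain m where m: "1 \<le> m" "m \<le> R" "m \<le> F (x + m) * G (x + 2 * m)"
      by (auto simp: hits_def)
    define n where "n = l * m - e"
    have lm: "l \<le> l * m" using m by simp
    have ln: "l * m = n + e" using e lm unfolding n_def by linarith
    have n: "1 \<le> n" "n \<le> l * m" using e lm ln by linarith+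
    have "t + n + r = l * (x + m) + e" using tr ln by (simp add: algebra_simps)
    hence F: "(t + n + r) div l = x + m" using l0 e by simp
    have "t + 2 * n + r = l * (x + 2 * m)"
      using tr ln by (simp add: algebra_simps)
    hence "spike l r G (t + 2 * n) = l * G (x + 2 * m)" using l0
      by (simp add: spike_def)
    moreover have "n \<le> l * (F (x + m) * G (x + 2 * m))"
    using n(2) mult_le_mono2[OF m(3), of l] by (rule le_trans)
    ultimately have "n \<le> F ((t + n + r) div l) * spike l r G (t + 2 * n)"
      using F by (simp add: mult.commute mult.left_commute)
    moreover have "n \<le> l * R" using n m l by (meson le_trans mult_le_mono2)
    ultimately show "hits (\<lambda>s. F ((s + r) div l)) (spike l r G) (l * R) t"
      using n(1) by (auto simp: hits_def)
  qed
qed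

section \<open>One-point laws of the dilated functions\<close>

definition coin :: "'a pmf \<Rightarrow> 'a pmf \<Rightarrow> 'a pmf" where
  "coin x y = bind_pmf (bernoulli_pmf (1 / 2)) (\<lambda>h. if h then x else y)"

text \<open>The law of a spike function at a single position: it is zero except with probability \<open>1 / l\<close>, and then \<open>l\<close> times
a sample of \<open>a\<close>, so the mean is that of \<open>a\<close>.\<close>

definition thin :: "nat \<Rightarrow> nat pmf \<Rightarrow> nat pmf" where
  "thin l a = bind_pmf (bernoulli_pmf (1 / real l)) (\<lambda>h. if h then map_pmf ((*) l) a else return_pmf 0)"

lemma map_pmf_coin: "map_pmf f (coin x y) = coin (map_pmf f x) (map_pmf f y)"
  by (simp add: coin_def map_bind_pmf if_distrib cong: if_cong)

lemma nn_integral_coin: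
  "(\<integral>\<^sup>+x. f x \<partial>coin x y) = ennreal (1/2) * (\<integral>\<^sup>+z. f z \<partial>x) + ennreal (1/2) * (\<integral>\<^sup>+z. f z \<partial>y)"
  by (simp add: coin_def mult.commute)

lemma prob_coin:
  "measure_pmf.prob (coin x y) A = (measure_pmf.prob x A + measure_pmf.prob y A) / 2"
proof -
  have e: "ennreal (1 / 2) * ennreal u = ennreal (u / 2)" if "0 \<le> u" for u
    using ennreal_mult[of "1 / 2" u, symmetric] that by simp
  have "ennreal (measure_pmf.prob (coin x y) A) =
    ennreal (1/2) * emeasure x A + ennreal (1/2) * emeasure y A"
    using nn_integral_coin[where f="indicator A" and x=x and y=y]
    by (simp flip: measure_pmf.emeasure_eq_measure)
  also have "\<dots> = ennreal ((measure_pmf.prob x A + measure_pmf.prob y A) / 2)"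
    by (simp only: measure_pmf.emeasure_eq_measure e measure_nonneg add_divide_distrib)
       (simp add: ennreal_plus)
  finally show ?thesis by simp
qed

lemma exists_unique_shift:
  fixes s c l :: nat
  assumes "0 < l"
  shows "\<exists>!r. r \<in> {c..<c + l} \<and> l dvd s + r"
proof -
  \<comment> \<open>\<open>s + r\<close> is the only multiple of \<open>l\<close> among \<open>s + c, \<dots>, s + c + l - 1\<close>.\<close>
  define r where "r = c + (l - 1 - (s + c + (l - 1)) mod l)"
  let ?q = "(s + c + (l - 1)) div l" and ?m = "(s + c + (l - 1)) mod l"
  have m: "?m < l" using assms by simp
  have "s + c + (l - 1) = l * ?q + ?m" by simp
  hence "s + r = l * ?q" unfolding r_def using m by linarith
  hence r: "r \<in> {c..<c + l}" "l dvd s + r" using assms by (auto simp: r_def)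
  show ?thesis
  proof (rule ex1I[of _ r])
    fix y assume y: "y \<in> {c..<c + l} \<and> l dvd s + y"
    have "l dvd s + y" "l dvd s + r" using y r by simp_all
    hence "l dvd (s + y) - (s + r)" "l dvd (s + r) - (s + y)" by (simp_all only: dvd_diff_nat)
    hence "l dvd y - r" "l dvd r - y" by simp_all
    moreover have "y - r < l" "r - y < l" using y r by auto
    ultimately have "y - r = 0" "r - y = 0" by (auto dest: dvd_imp_le)
    thus "y = r" by simp
  qed (use r in auto)
qed

lemma dvd_shift_bernoulli:
  assumes "0 < l"
  shows "map_pmf (\<lambda>r. l dvd s + r) (pmf_of_set {c..<c + l}) = bernoulli_pmf (1 / real l)"
proof -
  let ?A = "{c..<c + l}"
  have ne: "?A \<noteq> {}" "finite ?A" using assms by auto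
  obtain r0 where "r0 \<in> ?A" "\<And>r. r \<in> ?A \<and> l dvd s + r \<longleftrightarrow> r = r0"
    using exists_unique_shift[OF assms, of c s] by blast
  hence "?A \<inter> {r. l dvd s + r} = {r0}" by blast
  hence T: "measure_pmf.prob (pmf_of_set ?A) {r. l dvd s + r} = 1 / real l"
    by (simp add: measure_pmf_of_set[OF ne])
  have l1: "1 / real l \<le> 1" using assms by simp
  have "pmf (map_pmf (\<lambda>r. l dvd s + r) (pmf_of_set ?A)) True = 1 / real l"
    using T by (simp add: pmf_map vimage_def)
  moreover have "pmf (map_pmf (\<lambda>r. l dvd s + r) (pmf_of_set ?A)) False = 1 - 1 / real l"
    using T measure_pmf.prob_compl[of "{r. l dvd s + r}" "pmf_of_set ?A"]
    by (simp add: pmf_map vimage_def Compl_eq_Diff_UNIV[symmetric] Collect_neg_eq[symmetric])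
  ultimately show ?thesis using l1
    by (intro pmf_eqI) (case_tac i; simp)
qed

text \<open>The shift \<open>r\<close> is uniform over a full period, so each position carries a spike with probability
\<open>1 / l\<close>. Whatever the cell of that spike, the value of \<open>X\<close> there has law \<open>a\<close>.\<close>

lemma spike_law:
  assumes l: "0 < l" and X: "\<And>t. map_pmf (\<lambda>w. X w t) p = a"
  shows "map_pmf (\<lambda>(w, r). spike l r (X w) s) (pair_pmf p (pmf_of_set {c..<c + l})) = thin l a"
proof -
  have "map_pmf (\<lambda>(w, r). spike l r (X w) s) (pair_pmf p (pmf_of_set {c..<c + l})) =
    bind_pmf (pmf_of_set {c..<c + l}) (\<lambda>r. map_pmf (\<lambda>w. spike l r (X w) s) p)"
    by (subst pair_commute_pmf)
       (simp add: map_pmf_comp pair_pmf_eq_bind map_bind_pmf case_prod_beta')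
  also have "\<dots> = bind_pmf (pmf_of_set {c..<c + l})
     (\<lambda>r. if l dvd s + r then map_pmf ((*) l) a else return_pmf 0)"
  proof (rule bind_pmf_cong[OF refl])
    fix r
    have "map_pmf (\<lambda>w. l * X w ((s + r) div l)) p = map_pmf ((*) l) a"
      by (subst X[of "(s + r) div l", symmetric]) (simp add: map_pmf_comp)
    thus "map_pmf (\<lambda>w. spike l r (X w) s) p =
        (if l dvd s + r then map_pmf ((*) l) a else return_pmf 0)"
      by (simp add: spike_def)
  qed
  also have "\<dots> = bind_pmf (map_pmf (\<lambda>r. l dvd s + r) (pmf_of_set {c..<c + l}))
     (\<lambda>h. if h then map_pmf ((*) l) a else return_pmf 0)"
    by (simp add: bind_map_pmf)
  finally show ?thesis by (simp only: dvd_shift_bernoulli[OF l] thin_def)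
qed

lemma flat_law:
  assumes X: "\<And>t. map_pmf (\<lambda>w. X w t) p = a"
  shows "map_pmf (\<lambda>(w, r). X w (k r)) (pair_pmf p q) = a"
proof -
  have "map_pmf (\<lambda>(w, r). X w (k r)) (pair_pmf p q) = bind_pmf q (\<lambda>r. map_pmf (\<lambda>w. X w (k r)) p)"
    by (subst pair_commute_pmf)
       (simp add: map_pmf_comp pair_pmf_eq_bind map_bind_pmf case_prod_beta')
  thus ?thesis by (simp add: X)
qed

text \<open>Spikes of one block lie on a single residue class modulo \<open>l\<close>. This rigidity keeps repeated
meetings within the same blocks rare.\<close>

lemma spike_pair_prob:
  assumes l: "0 < l" and s: "s1 \<le> s2"
  shows "measure_pmf.prob (pair_pmf p (pmf_of_set {c..<c + l}))
      {(w, r). 0 < spike l r (X w) s1 \<and> 0 < spike l r (X w) s2}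
    \<le> (if l dvd s2 - s1 then 1 / real l else 0)"
proof -
  have "{(w, r). 0 < spike l r (X w) s1 \<and> 0 < spike l r (X w) s2} \<subseteq>
     UNIV \<times> {r. l dvd s1 + r \<and> l dvd s2 + r}"
    by (auto dest: spike_pos_imp_dvd)
  hence "measure_pmf.prob (pair_pmf p (pmf_of_set {c..<c + l}))
      {(w, r). 0 < spike l r (X w) s1 \<and> 0 < spike l r (X w) s2} \<le>
     measure_pmf.prob (pair_pmf p (pmf_of_set {c..<c + l})) (UNIV \<times> {r. l dvd s1 + r \<and> l dvd s2 + r})"
    by (intro measure_pmf.finite_measure_mono) auto
  also have "\<dots> = measure_pmf.prob (pmf_of_set {c..<c + l}) {r. l dvd s1 + r \<and> l dvd s2 + r}"
    by (simp only: prob_pair_pmf_Times) simp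
  also have "\<dots> \<le> (if l dvd s2 - s1 then 1 / real l else 0)"
  proof (cases "l dvd s2 - s1")
    case True
    have "measure_pmf.prob (pmf_of_set {c..<c + l}) {r. l dvd s1 + r \<and> l dvd s2 + r} \<le>
       measure_pmf.prob (pmf_of_set {c..<c + l}) {r. l dvd s1 + r}"
      by (intro measure_pmf.finite_measure_mono) auto
    also have "\<dots> = pmf (map_pmf (\<lambda>r. l dvd s1 + r) (pmf_of_set {c..<c + l})) True"
      by (simp add: pmf_map vimage_def)
    also have "\<dots> = 1 / real l" using l by (simp add: dvd_shift_bernoulli)
    finally show ?thesis using True by simp
  next
    case False
    have "s2 - s1 = (s2 + r) - (s1 + r)" for r using s by simp
    hence *: "{r. l dvd s1 + r \<and> l dvd s2 + r} = {}" using False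
      by (metis (mono_tags, lifting) Collect_empty_eq dvd_diff_nat)
    show ?thesis unfolding * using False by simp
  qed
  finally show ?thesis .
qed

lemma set_pmf_coin: "set_pmf (coin x y) = set_pmf x \<union> set_pmf y"
  by (auto simp: coin_def set_pmf_bernoulli split: if_splits)

lemma set_pmf_thin: "set_pmf (thin l a) \<subseteq> insert 0 ((*) l ` set_pmf a)"
  by (auto simp: thin_def split: if_splits)

lemma thin_le:
  assumes "set_pmf a \<subseteq> {..V}" "x \<in> set_pmf (thin l a)"
  shows "x \<le> l * V"
  using assms set_pmf_thin[of l a] by fastforce

lemma mean_coin:
  assumes "finite (set_pmf x)" "finite (set_pmf y)"
  shows "measure_pmf.expectation (coin x y) f =
    (measure_pmf.expectation x f + measure_pmf.expectation y f) / (2 :: real)"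
  unfolding coin_def using assms
  by (subst pmf_expectation_bind[where A=UNIV]) (auto simp: UNIV_bool split: if_splits)

lemma mean_thin:
  assumes "0 < l" "finite (set_pmf a)"
  shows "measure_pmf.expectation (thin l a) real = measure_pmf.expectation a real"
  unfolding thin_def using assms
  by (subst pmf_expectation_bind[where A=UNIV]) (auto simp: UNIV_bool split: if_splits)

lemma mean_prod_pair_pmf:
  fixes f :: "'a \<Rightarrow> real" and g :: "'b \<Rightarrow> real"
  assumes "finite (set_pmf p)" "finite (set_pmf q)"
  shows "measure_pmf.expectation (pair_pmf p q) (\<lambda>z. f (fst z) * g (snd z)) =
    measure_pmf.expectation p f * measure_pmf.expectation q g"
proof -
  have "measure_pmf.expectation (pair_pmf p q) (\<lambda>z. f (fst z) * g (snd z)) =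
     (\<Sum>z\<in>set_pmf p \<times> set_pmf q. f (fst z) * g (snd z) * (pmf p (fst z) * pmf q (snd z)))"
    using assms by (subst integral_measure_pmf_real[where A="set_pmf p \<times> set_pmf q"])
       (auto simp: pmf_pair intro!: sum.cong)
  also have "\<dots> = (\<Sum>x\<in>set_pmf p. f x * pmf p x) * (\<Sum>y\<in>set_pmf q. g y * pmf q y)"
    by (simp add: sum_product sum.cartesian_product case_prod_beta' mult_ac)
  also have "\<dots> = measure_pmf.expectation p f * measure_pmf.expectation q g"
    using assms
    by (simp add: integral_measure_pmf_real[where A="set_pmf p"] integral_measure_pmf_real[where A="set_pmf q"])
  finally show ?thesis .
qed

section \<open>One random block\<close>

type_synonym block = "bool \<times> (nat \<Rightarrow> nat) \<times> (nat \<Rightarrow> nat)"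

text \<open>A random pair of functions. The only stationarity asked for is that the law at a single position
is the same for all positions: this is preserved by a round of the construction, and it is what makes
the number of new hits computable. The joint law of several positions may depend on where they are.\<close>

definition process :: "((nat \<Rightarrow> nat) \<times> (nat \<Rightarrow> nat)) pmf \<Rightarrow> nat pmf \<Rightarrow> nat pmf \<Rightarrow> nat \<Rightarrow> real \<Rightarrow> bool" where
  "process p a b R c \<longleftrightarrow> (\<forall>t. map_pmf (\<lambda>w. fst w t) p = a) \<and> (\<forall>t. map_pmf (\<lambda>w. snd w t) p = b) \<and>
    (\<forall>t. c \<le> measure_pmf.prob p {w. hits (fst w) (snd w) R t})"

definition spikeF :: "block \<Rightarrow> nat \<Rightarrow> nat" where
  "spikeF z s = (if fst z then fst (snd z) s else 0)"

definition spikeG :: "block \<Rightarrow> nat \<Rightarrow> nat" where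
  "spikeG z s = (if fst z then 0 else snd (snd z) s)"

text \<open>The offset of the second dilation starts at \<open>l'\<close> instead of \<open>0\<close> because \<open>hits_spike_G\<close> may refer
a position to the preceding cell.\<close>

definition block :: "nat \<Rightarrow> nat \<Rightarrow> ((nat \<Rightarrow> nat) \<times> (nat \<Rightarrow> nat)) pmf \<Rightarrow> block pmf" where
  "block l l' p = coin
     (map_pmf (\<lambda>(w, r). (True, spike l r (fst w), \<lambda>s. snd w ((s + r + (l - 1)) div l)))
        (pair_pmf p (pmf_of_set {0..<0 + l})))
     (map_pmf (\<lambda>(w, r). (False, \<lambda>s. fst w ((s + r) div l'), spike l' r (snd w)))
        (pair_pmf p (pmf_of_set {l'..<l' + l'})))"

lemma hits_mono: "hits F G R t \<Longrightarrow> R \<le> R' \<Longrightarrow> hits F G R' t"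
  by (auto simp: hits_def)

context
  fixes p a b R c and l l' :: nat
  assumes pr: "process p a b R c" and l: "0 < l" and l': "odd l'"
begin

lemma odd_scale_pos: "0 < l'" using l' by (auto intro: Nat.gr0I)

lemma block_F_law: "map_pmf (\<lambda>z. fst (snd z) s) (block l l' p) = coin (thin l a) a"
proof -
  have "map_pmf (\<lambda>(w, r). spike l r (fst w) s) (pair_pmf p (pmf_of_set {0..<0 + l})) = thin l a"
    using pr by (intro spike_law l) (auto simp: process_def)
  moreover have "map_pmf (\<lambda>(w, r). fst w ((s + r) div l')) (pair_pmf p (pmf_of_set {l'..<l' + l'})) = a"
    using pr by (intro flat_law) (auto simp: process_def)
  ultimately show ?thesis by (simp add: block_def map_pmf_coin map_pmf_comp case_prod_beta')
qed

lemma block_G_law: "map_pmf (\<lambda>z. snd (snd z) s) (block l l' p) = coin b (thin l' b)"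
proof -
  have "map_pmf (\<lambda>(w, r). spike l' r (snd w) s) (pair_pmf p (pmf_of_set {l'..<l' + l'})) = thin l' b"
    using pr by (intro spike_law odd_scale_pos) (auto simp: process_def)
  moreover have "map_pmf (\<lambda>(w, r). snd w ((s + r + (l - 1)) div l)) (pair_pmf p (pmf_of_set {0..<0 + l})) = b"
    using pr by (intro flat_law) (auto simp: process_def)
  ultimately show ?thesis by (simp add: block_def map_pmf_coin map_pmf_comp case_prod_beta')
qed

lemma block_spikeF_law: "map_pmf (\<lambda>z. spikeF z s) (block l l' p) = coin (thin l a) (return_pmf 0)"
proof -
  have "map_pmf (\<lambda>(w, r). spike l r (fst w) s) (pair_pmf p (pmf_of_set {0..<0 + l})) = thin l a"
    using pr by (intro spike_law l) (auto simp: process_def)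
  thus ?thesis by (simp add: block_def map_pmf_coin map_pmf_comp case_prod_beta' spikeF_def)
qed

lemma block_spikeG_law: "map_pmf (\<lambda>z. spikeG z s) (block l l' p) = coin (return_pmf 0) (thin l' b)"
proof -
  have "map_pmf (\<lambda>(w, r). spike l' r (snd w) s) (pair_pmf p (pmf_of_set {l'..<l' + l'})) = thin l' b"
    using pr by (intro spike_law odd_scale_pos) (auto simp: process_def)
  thus ?thesis by (simp add: block_def map_pmf_coin map_pmf_comp case_prod_beta' spikeG_def)
qed

lemma block_spikeF_pair:
  assumes "s1 \<le> s2"
  shows "measure_pmf.prob (block l l' p) {z. 0 < spikeF z s1 \<and> 0 < spikeF z s2}
    \<le> (if l dvd s2 - s1 then 1 / real l else 0)"
proof -
  have "measure_pmf.prob (block l l' p) {z. 0 < spikeF z s1 \<and> 0 < spikeF z s2} =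
     measure_pmf.prob (pair_pmf p (pmf_of_set {0..<0 + l}))
      {(w, r). 0 < spike l r (fst w) s1 \<and> 0 < spike l r (fst w) s2} / 2"
    by (simp add: block_def prob_coin spikeF_def vimage_def case_prod_beta')
  also have "\<dots> \<le> measure_pmf.prob (pair_pmf p (pmf_of_set {0..<0 + l}))
      {(w, r). 0 < spike l r (fst w) s1 \<and> 0 < spike l r (fst w) s2}"
    by simp
  also have "\<dots> \<le> (if l dvd s2 - s1 then 1 / real l else 0)"
    by (rule spike_pair_prob[OF l assms])
  finally show ?thesis .
qed

lemma block_spikeG_pair:
  assumes "s1 \<le> s2"
  shows "measure_pmf.prob (block l l' p) {z. 0 < spikeG z s1 \<and> 0 < spikeG z s2}
    \<le> (if l' dvd s2 - s1 then 1 / real l' else 0)"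
proof -
  have "measure_pmf.prob (block l l' p) {z. 0 < spikeG z s1 \<and> 0 < spikeG z s2} =
     measure_pmf.prob (pair_pmf p (pmf_of_set {l'..<l' + l'}))
      {(w, r). 0 < spike l' r (snd w) s1 \<and> 0 < spike l' r (snd w) s2} / 2"
    by (simp add: block_def prob_coin spikeG_def vimage_def case_prod_beta')
  also have "\<dots> \<le> measure_pmf.prob (pair_pmf p (pmf_of_set {l'..<l' + l'}))
      {(w, r). 0 < spike l' r (snd w) s1 \<and> 0 < spike l' r (snd w) s2}"
    by simp
  also have "\<dots> \<le> (if l' dvd s2 - s1 then 1 / real l' else 0)"
    by (rule spike_pair_prob[OF odd_scale_pos assms])
  finally show ?thesis .
qed

lemma block_spikeF_pos: "measure_pmf.prob (block l l' p) {z. 0 < spikeF z s} \<le> 1 / real l"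
  using block_spikeF_pair[of s s] by simp

lemma block_spikeG_pos: "measure_pmf.prob (block l l' p) {z. 0 < spikeG z s} \<le> 1 / real l'"
  using block_spikeG_pair[of s s] by simp

text \<open>Either dilation preserves hits for each value of the random offset, so the hit probability of the
mixture is not smaller than before.\<close>

lemma block_hits:
  assumes "l \<le> l'" "0 \<le> c"
  shows "c \<le> measure_pmf.prob (block l l' p) {z. hits (fst (snd z)) (snd (snd z)) (l' * R) t}"
proof -
  have c: "c \<le> measure_pmf.prob p {w. hits (fst w) (snd w) R x}" for x
    using pr by (auto simp: process_def)
  let ?H = "\<lambda>(w, r). hits (spike l r (fst w)) (\<lambda>s. snd w ((s + r + (l - 1)) div l)) (l' * R) t"
  let ?K = "\<lambda>(w, r). hits (\<lambda>s. fst w ((s + r) div l')) (spike l' r (snd w)) (l' * R) t"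
  have "c \<le> measure_pmf.prob (pair_pmf (pmf_of_set {0..<0 + l}) p) {(r, w). ?H (w, r)}"
  proof -
    have "measure_pmf.prob (pmf_of_set {0..<0 + l}) UNIV * c \<le>
        measure_pmf.prob (pair_pmf (pmf_of_set {0..<0 + l}) p) {z. ?H (snd z, fst z)}"
    proof (rule prob_pair_pmf_ge[OF _ assms(2)])
      fix r
      have "{w. hits (fst w) (snd w) R ((t + r) div l)} \<subseteq> {w. ?H (w, r)}"
        using hits_spike_F[OF l] hits_mono mult_le_mono1[OF assms(1)] by fastforce
      hence "measure_pmf.prob p {w. hits (fst w) (snd w) R ((t + r) div l)} \<le> measure_pmf.prob p {w. ?H (w, r)}"
        by (intro measure_pmf.finite_measure_mono) auto
      with c show "c \<le> measure_pmf.prob p {z. ?H (snd (r, z), fst (r, z))}"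
        by (auto intro: order_trans)
    qed
    thus ?thesis by (simp add: case_prod_beta')
  qed
  moreover have "c \<le> measure_pmf.prob (pair_pmf (pmf_of_set {l'..<l' + l'}) p) {(r, w). ?K (w, r)}"
  proof -
    have "measure_pmf.prob (pmf_of_set {l'..<l' + l'}) UNIV * c \<le>
        measure_pmf.prob (pair_pmf (pmf_of_set {l'..<l' + l'}) p) {z. ?K (snd z, fst z)}"
    proof (rule prob_pair_pmf_ge[OF _ assms(2)])
      fix r assume "r \<in> set_pmf (pmf_of_set {l'..<l' + l'}) \<inter> UNIV"
      hence "l' \<le> r" using odd_scale_pos by simp
      from hits_spike_G[OF l' this] obtain x where x: "\<And>F G. hits F G R x \<Longrightarrow>
        hits (\<lambda>s. F ((s + r) div l')) (spike l' r G) (l' * R) t" by blast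
      hence "{w. hits (fst w) (snd w) R x} \<subseteq> {w. ?K (w, r)}" by auto
      hence "measure_pmf.prob p {w. hits (fst w) (snd w) R x} \<le> measure_pmf.prob p {w. ?K (w, r)}"
        by (intro measure_pmf.finite_measure_mono) auto
      with c show "c \<le> measure_pmf.prob p {z. ?K (snd (r, z), fst (r, z))}"
        by (auto intro: order_trans)
    qed
    thus ?thesis by (simp add: case_prod_beta')
  qed
  ultimately show ?thesis
    unfolding block_def prob_coin
    by (subst (1 2) pair_commute_pmf) (simp add: vimage_def case_prod_beta')
qed

end

section \<open>Independent blocks side by side\<close>

lemma div_add_le: "(a + k) div q \<le> a div q + (k :: nat)"
  by (induction k) (auto simp: div_Suc)

lemma card_close_multiples_le:
  assumes "0 < l"
  shows "real (card {i. i < j \<and> j - i < q \<and> l dvd j - i}) \<le> real q / real l"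
proof -
  have "{i. i < j \<and> j - i < q \<and> l dvd j - i} \<subseteq> (\<lambda>k. j - l * k) ` {1..q div l}"
  proof
    fix i assume "i \<in> {i. i < j \<and> j - i < q \<and> l dvd j - i}"
    then obtain k where k: "i < j" "j - i < q" "j - i = l * k" by auto
    have "1 \<le> k" using k by (cases k) auto
    moreover have "k \<le> q div l" using k assms
      by (simp add: less_eq_div_iff_mult_less_eq mult.commute)
    moreover have "i = j - l * k" using k by simp
    ultimately show "i \<in> (\<lambda>k. j - l * k) ` {1..q div l}" by auto
  qed
  hence "card {i. i < j \<and> j - i < q \<and> l dvd j - i} \<le> card {1..q div l}"
    by (rule surj_card_le[rotated]) simp
  hence "real (card {i. i < j \<and> j - i < q \<and> l dvd j - i}) \<le> real (q div l)" by simp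
  also have "\<dots> \<le> real q / real l" by (rule of_nat_div_le_of_nat)
  finally show ?thesis .
qed

text \<open>A position and its next \<open>K\<close> successors lie in one block of length \<open>q\<close> unless the random phase puts a
block boundary among them.\<close>

lemma prob_phase_inside:
  fixes q x K :: nat
  assumes "0 < q"
  shows "1 - real K / real q \<le> measure_pmf.prob (pmf_of_set {..<q}) {\<phi>. (x + \<phi>) mod q + K < q}"
proof -
  let ?P = "pmf_of_set {..<q}" and ?bad = "{\<phi>. \<not> (x + \<phi>) mod q + K < q}"
  have ne: "{..<q} \<noteq> {}" "finite {..<q}" using assms by auto
  have inj: "inj_on (\<lambda>\<phi>. (x + \<phi>) mod q) {..<q}"
  proof (rule inj_onI)
    fix u v assume uv: "u \<in> {..<q}" "v \<in> {..<q}" "(x + u) mod q = (x + v) mod q"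
    have "q dvd u - v"
      using uv(3) mod_eq_dvd_iff_nat[of "x + v" "x + u" q] by (cases "v \<le> u") simp_all
    moreover have "q dvd v - u"
      using uv(3) mod_eq_dvd_iff_nat[of "x + u" "x + v" q] by (cases "u \<le> v") simp_all
    moreover have "u - v < q" "v - u < q" using uv by auto
    ultimately have "u - v = 0" "v - u = 0" by (auto dest: dvd_imp_le)
    thus "u = v" by simp
  qed
  have "card ({..<q} \<inter> ?bad) = card ((\<lambda>\<phi>. (x + \<phi>) mod q) ` ({..<q} \<inter> ?bad))"
    by (rule card_image[symmetric], rule inj_on_subset[OF inj]) auto
  also have "\<dots> \<le> card {q - K..<q}" using assms by (intro card_mono) auto
  also have "\<dots> \<le> K" by simp
  finally have "real (card ({..<q} \<inter> ?bad)) / real q \<le> real K / real q"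
    by (intro divide_right_mono) auto
  hence "measure_pmf.prob ?P ?bad \<le> real K / real q"
    by (simp add: measure_pmf_of_set[OF ne])
  moreover have "measure_pmf.prob ?P ?bad = 1 - measure_pmf.prob ?P {\<phi>. (x + \<phi>) mod q + K < q}"
    by (subst measure_pmf.prob_compl[symmetric]) (auto intro!: arg_cong2[where f=measure])
  ultimately show ?thesis by simp
qed

text \<open>One round of the construction: \<open>l\<close> and \<open>l'\<close> are the scales of the \<open>F\<close>-spikes and the \<open>G\<close>-spikes, and \<open>q\<close> is
the length of a block. Coprimality, the parity of \<open>l'\<close> and \<open>q \<le> l * l'\<close> ensure that, seen from a given position,
the \<open>F\<close>-spikes of one block and the \<open>G\<close>-spikes of another meet for at most one \<open>n\<close>.\<close>

locale spreading =
  fixes p :: "((nat \<Rightarrow> nat) \<times> (nat \<Rightarrow> nat)) pmf" and a b :: "nat pmf"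
    and R V l l' q :: nat and c e :: real
  assumes pr: "process p a b R c" and c0: "0 \<le> c"
    and V: "set_pmf a \<subseteq> {..V}" "set_pmf b \<subseteq> {..V}" "1 \<le> V"
    and mean: "measure_pmf.expectation a real = e" "measure_pmf.expectation b real = e"
    and e: "0 \<le> e" "e \<le> 1"
    and l: "0 < l" "l \<le> l'" "odd l'" "coprime l l'"
    and q: "0 < q" "q \<le> l * l'"
begin

text \<open>The product of two spikes is at most \<open>l * V * (l' * V)\<close>, so a hit between them has at most this length.\<close>

definition "reach = l * l' * V\<^sup>2"

definition "window = l' * R + reach"

text \<open>Blocks are reused cyclically, which leaves finitely many independent random objects. Their number
is large enough for all blocks that are visible from one position within a distance of \<open>2 * window\<close> to be
different.\<close>

definition "blocks = 2 * window + 2"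

definition "\<Omega> = Pi_pmf {..<blocks} undefined (\<lambda>_. block l l' p)"

text \<open>The block containing \<open>s\<close>; the random phase \<open>\<phi>\<close> shifts the block boundaries.\<close>

definition "idx \<phi> s = ((s + \<phi>) div q) mod blocks"

definition "\<alpha> = coin (thin l a) (return_pmf 0)"

definition "\<beta> = coin (return_pmf 0) (thin l' b)"

definition "meet \<phi> x n \<omega> \<longleftrightarrow>
  n \<le> spikeF (\<omega> (idx \<phi> (x + n))) (x + n) * spikeG (\<omega> (idx \<phi> (x + 2 * n))) (x + 2 * n)"

definition "\<pi> n = measure_pmf.prob (pair_pmf \<alpha> \<beta>) {z. n \<le> fst z * snd z}"

lemma l'_pos: "0 < l'" using l by simp

lemma idx_less: "idx \<phi> s < blocks" by (simp add: idx_def blocks_def)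

lemma idx_eq_iff:
  assumes "x \<le> s1" "s1 \<le> s2" "s2 \<le> x + 2 * window"
  shows "idx \<phi> s1 = idx \<phi> s2 \<longleftrightarrow> (s1 + \<phi>) div q = (s2 + \<phi>) div q"
proof
  assume eq: "idx \<phi> s1 = idx \<phi> s2"
  have le: "(s1 + \<phi>) div q \<le> (s2 + \<phi>) div q" using assms by (intro div_le_mono) simp
  have "(s2 + \<phi>) div q \<le> (s1 + \<phi> + 2 * window) div q" using assms by (intro div_le_mono) simp
  also have "\<dots> \<le> (s1 + \<phi>) div q + 2 * window" by (rule div_add_le)
  finally have "(s2 + \<phi>) div q - (s1 + \<phi>) div q < blocks" by (simp add: blocks_def)
  moreover have "blocks dvd (s2 + \<phi>) div q - (s1 + \<phi>) div q"
    using eq le by (simp add: idx_def mod_eq_dvd_iff_nat[symmetric])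
  ultimately have "(s2 + \<phi>) div q - (s1 + \<phi>) div q = 0" by (auto dest: dvd_imp_le)
  thus "(s1 + \<phi>) div q = (s2 + \<phi>) div q" using le by simp
qed (simp add: idx_def)

lemma idx_neq:
  assumes "x \<le> s1" "s1 + q \<le> s2" "s2 \<le> x + 2 * window"
  shows "idx \<phi> s1 \<noteq> idx \<phi> s2"
proof -
  have "(s1 + \<phi> + q) div q \<le> (s2 + \<phi>) div q" using assms by (intro div_le_mono) simp
  hence "(s1 + \<phi>) div q < (s2 + \<phi>) div q" using q(1) by simp
  thus ?thesis using idx_eq_iff[of x s1 s2 \<phi>] assms by simp
qed

lemma idx_eq_imp_close:
  assumes "x \<le> s1" "s1 \<le> s2" "s2 \<le> x + 2 * window" "idx \<phi> s1 = idx \<phi> s2"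
  shows "s2 - s1 < q"
  using idx_neq[of x s1 s2 \<phi>] assms by (cases "s1 + q \<le> s2") auto

lemma component_law: "i < blocks \<Longrightarrow> map_pmf (\<lambda>\<omega>. h (\<omega> i)) \<Omega> = map_pmf h (block l l' p)"
  using Pi_pmf_component[of "{..<blocks}" i undefined "\<lambda>_. block l l' p"]
    map_pmf_comp[of h "\<lambda>\<omega>. \<omega> i" \<Omega>]
  by (simp add: \<Omega>_def)

lemma component_prob:
  assumes "i < blocks"
  shows "measure_pmf.prob \<Omega> {\<omega>. P (\<omega> i)} = measure_pmf.prob (block l l' p) {z. P z}"
proof -
  have "measure_pmf.prob (map_pmf (\<lambda>\<omega>. \<omega> i) \<Omega>) {z. P z} = measure_pmf.prob (block l l' p) {z. P z}"
    using component_law[OF assms, of "\<lambda>z. z"] by simp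
  thus ?thesis by (simp add: vimage_def)
qed

lemma \<Omega>_indep:
  assumes "I \<subseteq> {..<blocks}"
    and "\<And>\<omega> \<omega>'. (\<And>i. i \<in> I \<Longrightarrow> \<omega> i = \<omega>' i) \<Longrightarrow> f \<omega> = f \<omega>'"
    and "\<And>\<omega> \<omega>'. (\<And>i. i \<notin> I \<Longrightarrow> i < blocks \<Longrightarrow> \<omega> i = \<omega>' i) \<Longrightarrow> g \<omega> = g \<omega>'"
  shows "measure_pmf.prob \<Omega> {\<omega>. f \<omega> \<and> g \<omega>} =
    measure_pmf.prob \<Omega> {\<omega>. f \<omega>} * measure_pmf.prob \<Omega> {\<omega>. g \<omega>}"
  unfolding \<Omega>_def
proof (rule prob_Pi_pmf_indep[OF finite_lessThan assms(1)])
  show "f \<omega> = f \<omega>'" if "\<And>i. i \<in> I \<Longrightarrow> \<omega> i = \<omega>' i" for \<omega> \<omega>'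
    using that by (rule assms(2))
  show "g \<omega> = g \<omega>'" if "\<And>i. i \<in> {..<blocks} - I \<Longrightarrow> \<omega> i = \<omega>' i" for \<omega> \<omega>'
    using that by (intro assms(3)) simp
qed

lemma \<Omega>_indep1:
  assumes "i < blocks"
    and "\<And>\<omega> \<omega>'. (\<And>j. j \<noteq> i \<Longrightarrow> j < blocks \<Longrightarrow> \<omega> j = \<omega>' j) \<Longrightarrow> g \<omega> = g \<omega>'"
  shows "measure_pmf.prob \<Omega> {\<omega>. f (\<omega> i) \<and> g \<omega>} =
    measure_pmf.prob (block l l' p) {z. f z} * measure_pmf.prob \<Omega> {\<omega>. g \<omega>}"
proof -
  have "measure_pmf.prob \<Omega> {\<omega>. f (\<omega> i) \<and> g \<omega>} =
    measure_pmf.prob \<Omega> {\<omega>. f (\<omega> i)} * measure_pmf.prob \<Omega> {\<omega>. g \<omega>}"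
  proof (rule \<Omega>_indep[of "{i}"])
    show "{i} \<subseteq> {..<blocks}" using assms(1) by simp
    show "f (\<omega> i) = f (\<omega>' i)" if "\<And>j. j \<in> {i} \<Longrightarrow> \<omega> j = \<omega>' j" for \<omega> \<omega>' :: "nat \<Rightarrow> block"
      using that by simp
    show "g \<omega> = g \<omega>'" if "\<And>j. j \<notin> {i} \<Longrightarrow> j < blocks \<Longrightarrow> \<omega> j = \<omega>' j" for \<omega> \<omega>'
      using that by (intro assms(2)) simp
  qed
  thus ?thesis by (simp only: component_prob[OF assms(1)])
qed

text \<open>Since \<open>n \<ge> q\<close>, the two spikes sit in different blocks, so they are independent.\<close>

lemma meet_prob:
  assumes n: "q \<le> n" "n \<le> reach"
  shows "measure_pmf.prob \<Omega> {\<omega>. meet \<phi> x n \<omega>} = \<pi> n"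
proof -
  let ?i = "idx \<phi> (x + n)" and ?j = "idx \<phi> (x + 2 * n)"
  have ij: "?i \<noteq> ?j" using n by (intro idx_neq[of x]) (auto simp: window_def)
  have "map_pmf (\<lambda>\<omega>. (spikeF (\<omega> ?i) (x + n), spikeG (\<omega> ?j) (x + 2 * n))) \<Omega> =
     pair_pmf (map_pmf (\<lambda>\<omega>. spikeF (\<omega> ?i) (x + n)) \<Omega>) (map_pmf (\<lambda>\<omega>. spikeG (\<omega> ?j) (x + 2 * n)) \<Omega>)"
    unfolding \<Omega>_def
  proof (rule Pi_pmf_indep[where I="{?i}"])
    show "{?i} \<subseteq> {..<blocks}" using idx_less by simp
    show "spikeG (\<omega> ?j) (x + 2 * n) = spikeG (\<omega>' ?j) (x + 2 * n)"
      if "\<And>k. k \<in> {..<blocks} - {?i} \<Longrightarrow> \<omega> k = \<omega>' k" for \<omega> \<omega>' :: "nat \<Rightarrow> block"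
      using that[of ?j] ij idx_less by simp
  qed simp_all
  also have "map_pmf (\<lambda>\<omega>. spikeF (\<omega> ?i) (x + n)) \<Omega> = \<alpha>"
    by (subst component_law[OF idx_less]) (simp add: block_spikeF_law[OF pr l(1,3)] \<alpha>_def)
  also have "map_pmf (\<lambda>\<omega>. spikeG (\<omega> ?j) (x + 2 * n)) \<Omega> = \<beta>"
    by (subst component_law[OF idx_less]) (simp add: block_spikeG_law[OF pr l(1,3)] \<beta>_def)
  finally have "\<pi> n = measure_pmf.prob
      (map_pmf (\<lambda>\<omega>. (spikeF (\<omega> ?i) (x + n), spikeG (\<omega> ?j) (x + 2 * n))) \<Omega>) {z. n \<le> fst z * snd z}"
    by (simp only: \<pi>_def)
  thus ?thesis by (simp add: vimage_def meet_def)
qed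

lemma \<pi>_nonneg: "0 \<le> \<pi> n" by (simp add: \<pi>_def)

lemma finite_laws: "finite (set_pmf a)" "finite (set_pmf b)" "finite (set_pmf (thin l a))"
  "finite (set_pmf (thin l' b))" "finite (set_pmf \<alpha>)" "finite (set_pmf \<beta>)"
proof -
  show a: "finite (set_pmf a)" "finite (set_pmf b)" using V finite_subset by auto
  show "finite (set_pmf (thin l a))" "finite (set_pmf (thin l' b))"
    by (rule finite_subset[OF set_pmf_thin]; use a in simp)+
  thus "finite (set_pmf \<alpha>)" "finite (set_pmf \<beta>)" by (auto simp: \<alpha>_def \<beta>_def set_pmf_coin)
qed

text \<open>The coin halves the mean of the spikes on either side, so the sum of the probabilities over all lengths is
\<open>(e / 2) * (e / 2)\<close>.\<close>

lemma sum_\<pi>: "(\<Sum>n\<in>{1..<reach + 1}. \<pi> n) = e\<^sup>2 / 4"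
proof -
  have "fst z * snd z < reach + 1" if "z \<in> set_pmf (pair_pmf \<alpha> \<beta>)" for z
  proof -
    have "fst z \<le> l * V" "snd z \<le> l' * V"
      using that thin_le[OF V(1), of _ l] thin_le[OF V(2), of _ l']
      by (auto simp: \<alpha>_def \<beta>_def set_pmf_coin)
    hence "fst z * snd z \<le> (l * V) * (l' * V)" by (rule mult_le_mono)
    thus ?thesis by (simp add: reach_def power2_eq_square mult_ac)
  qed
  hence "(\<Sum>n\<in>{1..<reach + 1}. \<pi> n) =
     measure_pmf.expectation (pair_pmf \<alpha> \<beta>) (\<lambda>z. real (fst z * snd z))"
    unfolding \<pi>_def by (rule layer_cake_pmf[symmetric])
  also have "\<dots> = measure_pmf.expectation \<alpha> real * measure_pmf.expectation \<beta> real"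
    using mean_prod_pair_pmf[OF finite_laws(5,6), of real real] by simp
  also have "measure_pmf.expectation \<alpha> real = e / 2"
    by (simp add: \<alpha>_def mean_coin finite_laws mean_thin l mean)
  also have "measure_pmf.expectation \<beta> real = e / 2"
    by (simp add: \<beta>_def mean_coin finite_laws mean_thin l'_pos mean)
  finally show ?thesis by (simp add: power2_eq_square)
qed

lemma \<pi>_le: "1 \<le> n \<Longrightarrow> \<pi> n \<le> 1 / (real l * real l')"
proof -
  assume n: "1 \<le> n"
  have "\<pi> n \<le> measure_pmf.prob (pair_pmf \<alpha> \<beta>) ({x. 0 < x} \<times> {x. 0 < x})"
    unfolding \<pi>_def using n by (intro measure_pmf.finite_measure_mono) (auto intro: Nat.gr0I)
  also have "\<dots> = measure_pmf.prob \<alpha> {x. 0 < x} * measure_pmf.prob \<beta> {x. 0 < x}"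
    by (rule prob_pair_pmf_Times)
  also have "\<dots> \<le> (1 / real l) * (1 / real l')"
  proof (rule mult_mono)
    show "measure_pmf.prob \<alpha> {x. 0 < x} \<le> 1 / real l"
    proof -
      have "measure_pmf.prob (map_pmf (\<lambda>z. spikeF z 0) (block l l' p)) {x. 0 < x} \<le> 1 / real l"
        using block_spikeF_pos[OF pr l(1,3), of 0] by (simp add: vimage_def)
      thus ?thesis by (simp only: block_spikeF_law[OF pr l(1,3)] \<alpha>_def)
    qed
    show "measure_pmf.prob \<beta> {x. 0 < x} \<le> 1 / real l'"
    proof -
      have "measure_pmf.prob (map_pmf (\<lambda>z. spikeG z 0) (block l l' p)) {x. 0 < x} \<le> 1 / real l'"
        using block_spikeG_pos[OF pr l(1,3), of 0] by (simp add: vimage_def)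
      thus ?thesis by (simp only: block_spikeG_law[OF pr l(1,3)] \<beta>_def)
    qed
  qed auto
  finally show ?thesis by simp
qed

section \<open>New hits between different blocks\<close>

lemma component_triple:
  assumes "i < blocks" "j < blocks" "k < blocks" "i \<noteq> j" "i \<noteq> k" "j \<noteq> k"
  shows "measure_pmf.prob \<Omega> {\<omega>. f (\<omega> i) \<and> g (\<omega> j) \<and> h (\<omega> k)} =
    measure_pmf.prob (block l l' p) {z. f z} *
    (measure_pmf.prob (block l l' p) {z. g z} * measure_pmf.prob (block l l' p) {z. h z})"
proof -
  have "measure_pmf.prob \<Omega> {\<omega>. f (\<omega> i) \<and> (g (\<omega> j) \<and> h (\<omega> k))} =
    measure_pmf.prob (block l l' p) {z. f z} * measure_pmf.prob \<Omega> {\<omega>. g (\<omega> j) \<and> h (\<omega> k)}"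
    using assms by (intro \<Omega>_indep1) auto
  also have "measure_pmf.prob \<Omega> {\<omega>. g (\<omega> j) \<and> h (\<omega> k)} =
    measure_pmf.prob (block l l' p) {z. g z} * measure_pmf.prob \<Omega> {\<omega>. h (\<omega> k)}"
    using assms by (intro \<Omega>_indep1) auto
  finally show ?thesis by (simp only: component_prob[OF assms(3)])
qed

text \<open>The excess over independence that is caused by two \<open>F\<close>-spikes, respectively two \<open>G\<close>-spikes, lying in
the same block.\<close>

definition "clash n1 n2 =
  (if n2 - n1 < q \<and> l dvd n2 - n1 then 1 / (real l * (real l')\<^sup>2) else 0) +
  (if n2 - n1 < q \<and> l' dvd n2 - n1 then 1 / (real l' * (real l)\<^sup>2) else 0)"

lemma clash_nonneg: "0 \<le> clash n1 n2"
  by (simp add: clash_def)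

text \<open>Two meetings involve up to four blocks. If these are distinct, the meetings are independent. If the
\<open>F\<close>-spikes share a block, their distance is a multiple of \<open>l\<close> that is smaller than \<open>q\<close>; similarly
for the \<open>G\<close>-spikes. If both are shared, the distance would be a multiple of \<open>l * l'\<close>, which is too
long. A block never provides an \<open>F\<close>-spike and a \<open>G\<close>-spike at once.\<close>

lemma meet_pair:
  assumes n: "q \<le> n1" "n1 < n2" "n2 \<le> reach"
  shows "measure_pmf.prob \<Omega> {\<omega>. meet \<phi> x n1 \<omega> \<and> meet \<phi> x n2 \<omega>} \<le> \<pi> n1 * \<pi> n2 + clash n1 n2"
proof -
  let ?i1 = "idx \<phi> (x + n1)" and ?j1 = "idx \<phi> (x + 2 * n1)"
  let ?i2 = "idx \<phi> (x + n2)" and ?j2 = "idx \<phi> (x + 2 * n2)"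
  let ?P = "measure_pmf.prob \<Omega>" and ?b = "measure_pmf.prob (block l l' p)"
  have ne: "?i1 \<noteq> ?j1" "?i2 \<noteq> ?j2" "?i1 \<noteq> ?j2"
    using n by (intro idx_neq[of x]; simp add: window_def)+
  have pos: "0 < spikeF (\<omega> (idx \<phi> (x + m))) (x + m)" "0 < spikeG (\<omega> (idx \<phi> (x + 2 * m))) (x + 2 * m)"
    if "meet \<phi> x m \<omega>" "q \<le> m" for m \<omega>
    using that q(1) by (auto simp: meet_def intro!: Nat.gr0I)
  have n1': "q \<le> n2" using n by simp
  have F2: "?b {z. 0 < spikeF z (x + n1) \<and> 0 < spikeF z (x + n2)} \<le> (if l dvd n2 - n1 then 1 / real l else 0)"
    using block_spikeF_pair[OF pr l(1,3), of "x + n1" "x + n2"] n by simp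
  have dvd2: "l' dvd 2 * (n2 - n1) \<longleftrightarrow> l' dvd n2 - n1"
    using l(3) by (intro coprime_dvd_mult_right_iff) simp
  have "x + 2 * n2 - (x + 2 * n1) = 2 * (n2 - n1)" using n by simp
  hence G2: "?b {z. 0 < spikeG z (x + 2 * n1) \<and> 0 < spikeG z (x + 2 * n2)} \<le> (if l' dvd n2 - n1 then 1 / real l' else 0)"
    using block_spikeG_pair[OF pr l(1,3), of "x + 2 * n1" "x + 2 * n2"] n dvd2 by simp
  have F1: "?b {z. 0 < spikeF z s} \<le> 1 / real l" for s by (rule block_spikeF_pos[OF pr l(1,3)])
  have G1: "?b {z. 0 < spikeG z s} \<le> 1 / real l'" for s by (rule block_spikeG_pos[OF pr l(1,3)])
  have pp: "0 \<le> \<pi> n1 * \<pi> n2" by (simp add: \<pi>_nonneg)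
  consider (both) "?i1 = ?i2" "?j1 = ?j2" | (F) "?i1 = ?i2" "?j1 \<noteq> ?j2"
    | (G) "?i1 \<noteq> ?i2" "?j1 = ?j2" | (cross) "?i1 \<noteq> ?i2" "?j1 \<noteq> ?j2" "?j1 = ?i2"
    | (indep) "?i1 \<noteq> ?i2" "?j1 \<noteq> ?j2" "?j1 \<noteq> ?i2" by blast
  thus ?thesis
  proof cases
    case both
    have close: "n2 - n1 < q"
      using idx_eq_imp_close[of x "x + n1" "x + n2" \<phi>] both n by (simp add: window_def)
    have "?P {\<omega>. meet \<phi> x n1 \<omega> \<and> meet \<phi> x n2 \<omega>} \<le>
        ?P {\<omega>. 0 < spikeF (\<omega> ?i1) (x + n1) \<and> 0 < spikeF (\<omega> ?i1) (x + n2)}"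
      using pos n n1' both by (intro measure_pmf.finite_measure_mono) fastforce+
    also have "\<dots> \<le> (if l dvd n2 - n1 then 1 / real l else 0)"
      using component_prob[OF idx_less, of "\<lambda>z. 0 < spikeF z (x + n1) \<and> 0 < spikeF z (x + n2)"] F2 by simp
    finally have 1: "?P {\<omega>. meet \<phi> x n1 \<omega> \<and> meet \<phi> x n2 \<omega>} \<le> (if l dvd n2 - n1 then 1 / real l else 0)" .
    have "?P {\<omega>. meet \<phi> x n1 \<omega> \<and> meet \<phi> x n2 \<omega>} \<le>
        ?P {\<omega>. 0 < spikeG (\<omega> ?j1) (x + 2 * n1) \<and> 0 < spikeG (\<omega> ?j1) (x + 2 * n2)}"
      using pos n n1' both by (intro measure_pmf.finite_measure_mono) fastforce+
    also have "\<dots> \<le> (if l' dvd n2 - n1 then 1 / real l' else 0)"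
      using component_prob[OF idx_less, of "\<lambda>z. 0 < spikeG z (x + 2 * n1) \<and> 0 < spikeG z (x + 2 * n2)"] G2 by simp
    finally have 2: "?P {\<omega>. meet \<phi> x n1 \<omega> \<and> meet \<phi> x n2 \<omega>} \<le> (if l' dvd n2 - n1 then 1 / real l' else 0)" .
    have "\<not> (l dvd n2 - n1 \<and> l' dvd n2 - n1)"
    proof
      assume "l dvd n2 - n1 \<and> l' dvd n2 - n1"
      hence "l * l' dvd n2 - n1" using l(4) by (simp add: divides_mult)
      hence "l * l' \<le> n2 - n1" using n by (intro dvd_imp_le) auto
      thus False using close q by simp
    qed
    hence "?P {\<omega>. meet \<phi> x n1 \<omega> \<and> meet \<phi> x n2 \<omega>} \<le> 0" using 1 2 by (auto split: if_splits)
    thus ?thesis using pp clash_nonneg[of n1 n2] by linarith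
  next
    case F
    have close: "n2 - n1 < q"
      using idx_eq_imp_close[of x "x + n1" "x + n2" \<phi>] F n by (simp add: window_def)
    have "?P {\<omega>. meet \<phi> x n1 \<omega> \<and> meet \<phi> x n2 \<omega>} \<le>
        ?P {\<omega>. (0 < spikeF (\<omega> ?i1) (x + n1) \<and> 0 < spikeF (\<omega> ?i1) (x + n2)) \<and>
          0 < spikeG (\<omega> ?j1) (x + 2 * n1) \<and> 0 < spikeG (\<omega> ?j2) (x + 2 * n2)}"
      using pos n n1' F by (intro measure_pmf.finite_measure_mono) fastforce+
    also have "\<dots> = ?b {z. 0 < spikeF z (x + n1) \<and> 0 < spikeF z (x + n2)} *
        (?b {z. 0 < spikeG z (x + 2 * n1)} * ?b {z. 0 < spikeG z (x + 2 * n2)})"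
      using ne F by (intro component_triple) (auto simp: idx_less)
    also have "\<dots> \<le> (if l dvd n2 - n1 then 1 / real l else 0) * (1 / real l' * (1 / real l'))"
      by (intro mult_mono F2 G1) auto
    also have "\<dots> \<le> clash n1 n2" using close by (simp add: clash_def power2_eq_square)
    finally show ?thesis using pp by linarith
  next
    case G
    have close: "n2 - n1 < q"
      using idx_eq_imp_close[of x "x + 2 * n1" "x + 2 * n2" \<phi>] G n by (simp add: window_def)
    have "?P {\<omega>. meet \<phi> x n1 \<omega> \<and> meet \<phi> x n2 \<omega>} \<le>
        ?P {\<omega>. (0 < spikeG (\<omega> ?j1) (x + 2 * n1) \<and> 0 < spikeG (\<omega> ?j1) (x + 2 * n2)) \<and>
          0 < spikeF (\<omega> ?i1) (x + n1) \<and> 0 < spikeF (\<omega> ?i2) (x + n2)}"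
      using pos n n1' G by (intro measure_pmf.finite_measure_mono) fastforce+
    also have "\<dots> = ?b {z. 0 < spikeG z (x + 2 * n1) \<and> 0 < spikeG z (x + 2 * n2)} *
        (?b {z. 0 < spikeF z (x + n1)} * ?b {z. 0 < spikeF z (x + n2)})"
      using ne G by (intro component_triple) (auto simp: idx_less)
    also have "\<dots> \<le> (if l' dvd n2 - n1 then 1 / real l' else 0) * (1 / real l * (1 / real l))"
      by (intro mult_mono G2 F1) auto
    also have "\<dots> \<le> clash n1 n2" using close by (simp add: clash_def power2_eq_square)
    finally show ?thesis using pp by linarith
  next
    case cross
    have no: "\<not> (meet \<phi> x n1 \<omega> \<and> meet \<phi> x n2 \<omega>)" for \<omega>
      using pos(2)[of n1 \<omega>] pos(1)[of n2 \<omega>] n n1' cross(3) by (auto simp: spikeF_def spikeG_def split: if_splits)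
    have "?P {\<omega>. meet \<phi> x n1 \<omega> \<and> meet \<phi> x n2 \<omega>} = 0" by (simp add: no)
    thus ?thesis using pp clash_nonneg[of n1 n2] by linarith
  next
    case indep
    have "?P {\<omega>. meet \<phi> x n1 \<omega> \<and> meet \<phi> x n2 \<omega>} =
      ?P {\<omega>. meet \<phi> x n1 \<omega>} * ?P {\<omega>. meet \<phi> x n2 \<omega>}"
    proof (rule \<Omega>_indep[of "{?i1, ?j1}"])
      show "{?i1, ?j1} \<subseteq> {..<blocks}" using idx_less by simp
      show "meet \<phi> x n1 \<omega> = meet \<phi> x n1 \<omega>'"
        if "\<And>i. i \<in> {?i1, ?j1} \<Longrightarrow> \<omega> i = \<omega>' i" for \<omega> \<omega>'
        using that[of ?i1] that[of ?j1] by (simp add: meet_def)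
      show "meet \<phi> x n2 \<omega> = meet \<phi> x n2 \<omega>'"
        if "\<And>i. i \<notin> {?i1, ?j1} \<Longrightarrow> i < blocks \<Longrightarrow> \<omega> i = \<omega>' i" for \<omega> \<omega>'
        using that[of ?i2] that[of ?j2] ne indep idx_less by (simp add: meet_def)
    qed
    also have "\<dots> = \<pi> n1 * \<pi> n2" using n by (simp add: meet_prob)
    finally show ?thesis using clash_nonneg[of n1 n2] by linarith
  qed
qed

lemma sum_clash_le: "(\<Sum>i<j. clash i j) \<le> 2 * real q / (real l * real l')\<^sup>2"
proof -
  have s: "(\<Sum>i<j. if j - i < q \<and> k dvd j - i then u else 0) \<le> real q / real k * u"
    if "0 < k" "0 \<le> u" for k and u :: real
  proof -
    have "(\<Sum>i<j. if j - i < q \<and> k dvd j - i then u else 0) =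
       real (card {i. i < j \<and> j - i < q \<and> k dvd j - i}) * u"
      by (subst sum.inter_filter[symmetric]) (auto simp: lessThan_def)
    also have "\<dots> \<le> real q / real k * u"
      using that by (intro mult_right_mono card_close_multiples_le)
    finally show ?thesis .
  qed
  have "(\<Sum>i<j. clash i j) \<le> real q / real l * (1 / (real l * (real l')\<^sup>2)) +
      real q / real l' * (1 / (real l' * (real l)\<^sup>2))"
    unfolding clash_def sum.distrib using l l'_pos by (intro add_mono s) auto
  also have "\<dots> = 2 * real q / (real l * real l')\<^sup>2" using l l'_pos
    by (simp add: power2_eq_square field_simps)
  finally show ?thesis .
qed

text \<open>The second Bonferroni inequality. The first-order sum \<open>S\<close> is \<open>e\<^sup>2 / 4\<close> up to the lengths below \<open>q\<close>, which
contribute at most \<open>q / (l * l')\<close>. The second-order sum is at most \<open>S\<^sup>2 \<le> e\<^sup>2 / 16\<close> plus the clashes, which are of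
order \<open>V\<^sup>2 * q / (l * l')\<close>. Both error terms are negligible when the blocks are short
compared with \<open>l * l'\<close>.\<close>

lemma meet_some_prob:
  assumes small: "80 * (real V)\<^sup>2 * (real q / (real l * real l')) \<le> e\<^sup>2"
  shows "e\<^sup>2 / 8 \<le> measure_pmf.prob \<Omega> {\<omega>. \<exists>n\<in>{q..reach}. meet \<phi> x n \<omega>}"
proof -
  define A where "A = real q / (real l * real l')"
  \<comment> \<open>Lengths below \<open>q\<close> are left out: their two spikes could lie in one block.\<close>
  define E where "E n = (if q \<le> n then {\<omega>. meet \<phi> x n \<omega>} else {})" for n
  define \<rho> where "\<rho> n = (if q \<le> n then \<pi> n else 0)" for n
  let ?P = "measure_pmf.prob \<Omega>" and ?m = "reach + 1"
  have V1: "1 \<le> real V" using V by simp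
  have l1: "0 < real l * real l'" using l l'_pos by simp
  have A0: "0 \<le> A" by (simp add: A_def)
  have \<rho>0: "0 \<le> \<rho> n" for n by (simp add: \<rho>_def \<pi>_nonneg)
  have PE: "?P (E n) = \<rho> n" if "n < ?m" for n
    using that by (simp add: E_def \<rho>_def meet_prob)
  have PEE: "?P (E i \<inter> E j) \<le> \<rho> i * \<rho> j + clash i j" if "i < j" "j < ?m" for i j
  proof (cases "q \<le> i")
    case True
    have "E i \<inter> E j = {\<omega>. meet \<phi> x i \<omega> \<and> meet \<phi> x j \<omega>}" using True that by (auto simp: E_def)
    thus ?thesis using meet_pair[of i j \<phi> x] True that by (simp add: \<rho>_def)
  qed (simp add: E_def \<rho>_def clash_nonneg)
  define S where "S = (\<Sum>n<?m. \<rho> n)"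
  have S_eq: "S = (\<Sum>n\<in>{1..<?m}. \<rho> n)"
    unfolding S_def using q(1)
    by (intro sum.mono_neutral_right) (auto simp: \<rho>_def not_le)
  have S0: "0 \<le> S" unfolding S_def by (intro sum_nonneg \<rho>0)
  have "S \<le> (\<Sum>n\<in>{1..<?m}. \<pi> n)" unfolding S_eq
    by (intro sum_mono) (simp add: \<rho>_def \<pi>_nonneg)
  hence S_le: "S \<le> e\<^sup>2 / 4" by (simp only: sum_\<pi>)
  have "(\<Sum>n\<in>{1..<?m}. \<pi> n) - S = (\<Sum>n\<in>{1..<?m}. if n < q then \<pi> n else 0)"
    unfolding S_eq sum_subtractf[symmetric] by (intro sum.cong) (auto simp: \<rho>_def)
  also have "\<dots> = (\<Sum>n\<in>{n\<in>{1..<?m}. n < q}. \<pi> n)" by (subst sum.inter_filter) auto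
  also have "\<dots> \<le> (\<Sum>n\<in>{n\<in>{1..<?m}. n < q}. 1 / (real l * real l'))"
    by (intro sum_mono \<pi>_le) auto
  also have "\<dots> = real (card {n\<in>{1..<?m}. n < q}) * (1 / (real l * real l'))" by simp
  also have "\<dots> \<le> real q * (1 / (real l * real l'))"
  proof (intro mult_right_mono)
    have "card {n\<in>{1..<?m}. n < q} \<le> card {..<q}" by (intro card_mono) auto
    thus "real (card {n\<in>{1..<?m}. n < q}) \<le> real q" by simp
  qed simp
  finally have S_ge: "e\<^sup>2 / 4 - A \<le> S" by (simp only: sum_\<pi>) (simp add: A_def)
  have "(\<Sum>j<?m. \<Sum>i<j. ?P (E i \<inter> E j)) \<le> (\<Sum>j<?m. \<Sum>i<j. \<rho> i * \<rho> j + clash i j)"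
    by (intro sum_mono PEE) auto
  also have "\<dots> = (\<Sum>j<?m. \<Sum>i<j. \<rho> i * \<rho> j) + (\<Sum>j<?m. \<Sum>i<j. clash i j)"
    by (simp add: sum.distrib)
  also have "(\<Sum>j<?m. \<Sum>i<j. \<rho> i * \<rho> j) \<le> (\<Sum>j<?m. \<Sum>i<?m. \<rho> i * \<rho> j)"
    by (intro sum_mono sum_mono2) (auto simp: \<rho>0)
  also have "\<dots> = S\<^sup>2"
    unfolding S_def power2_eq_square sum_product by (intro sum.cong refl mult.commute)
  also have "(\<Sum>j<?m. \<Sum>i<j. clash i j) \<le> (\<Sum>j<?m. 2 * real q / (real l * real l')\<^sup>2)"
    by (intro sum_mono sum_clash_le)
  also have "\<dots> = real ?m * (2 * real q / (real l * real l')\<^sup>2)" by simp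
  also have "\<dots> \<le> 2 * (real l * real l' * (real V)\<^sup>2) * (2 * real q / (real l * real l')\<^sup>2)"
  proof (intro mult_right_mono)
    have "1 \<le> reach" using l l'_pos V by (simp add: reach_def)
    hence "real ?m \<le> 2 * real reach" by simp
    thus "real ?m \<le> 2 * (real l * real l' * (real V)\<^sup>2)" by (simp add: reach_def)
  qed simp
  also have "\<dots> = 4 * (real V)\<^sup>2 * A" using l1 unfolding A_def
    by (simp add: power2_eq_square field_simps)
  finally have pairs: "(\<Sum>j<?m. \<Sum>i<j. ?P (E i \<inter> E j)) \<le> S\<^sup>2 + 4 * (real V)\<^sup>2 * A" by simp
  have "(\<Sum>j<?m. ?P (E j)) - (\<Sum>j<?m. \<Sum>i<j. ?P (E i \<inter> E j)) \<le> ?P (\<Union>j<?m. E j)"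
    by (rule measure_pmf.bonferroni_lower) simp
  also have "(\<Union>j<?m. E j) = {\<omega>. \<exists>n\<in>{q..reach}. meet \<phi> x n \<omega>}"
    by (auto simp: E_def Bex_def less_Suc_eq_le split: if_splits)
  also have "(\<Sum>j<?m. ?P (E j)) = S" unfolding S_def by (intro sum.cong PE) auto
  finally have main: "S - S\<^sup>2 - 4 * (real V)\<^sup>2 * A \<le> ?P {\<omega>. \<exists>n\<in>{q..reach}. meet \<phi> x n \<omega>}"
    using pairs by linarith
  have e2: "e\<^sup>2 \<le> 1" using e by (simp add: power_le_one)
  have "S * S \<le> (e\<^sup>2 / 4) * (1 / 4)" using S_le S0 e2 by (intro mult_mono) auto
  hence "S\<^sup>2 \<le> e\<^sup>2 / 16" by (simp add: power2_eq_square)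
  moreover have "A \<le> (real V)\<^sup>2 * A" using A0 V1 by (simp add: mult_le_cancel_right1 one_le_power)
  moreover have "80 * ((real V)\<^sup>2 * A) \<le> e\<^sup>2" using small by (simp add: A_def)
  ultimately show ?thesis using main S_ge by linarith
qed

section \<open>One round of the construction\<close>

definition "newF \<phi> \<omega> s = fst (snd (\<omega> (idx \<phi> s))) s"

definition "newG \<phi> \<omega> s = snd (snd (\<omega> (idx \<phi> s))) s"

definition "joined = map_pmf (\<lambda>(\<phi>, \<omega>). (newF \<phi> \<omega>, newG \<phi> \<omega>)) (pair_pmf (pmf_of_set {..<q}) \<Omega>)"

lemma joined_F_law: "map_pmf (\<lambda>w. fst w t) joined = coin (thin l a) a"
proof -
  have "map_pmf (\<lambda>w. fst w t) joined =
      bind_pmf (pmf_of_set {..<q}) (\<lambda>\<phi>. map_pmf (\<lambda>\<omega>. fst (snd (\<omega> (idx \<phi> t))) t) \<Omega>)"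
    by (simp add: joined_def map_pmf_comp pair_pmf_eq_bind map_bind_pmf case_prod_beta' newF_def)
  also have "\<dots> = bind_pmf (pmf_of_set {..<q}) (\<lambda>\<phi>. coin (thin l a) a)"
  proof (rule bind_pmf_cong[OF refl])
    show "map_pmf (\<lambda>\<omega>. fst (snd (\<omega> (idx \<phi> t))) t) \<Omega> = coin (thin l a) a" for \<phi>
      using component_law[OF idx_less, of "\<lambda>z. fst (snd z) t" \<phi> t] block_F_law[OF pr l(1,3)] by simp
  qed
  finally show ?thesis by simp
qed

lemma joined_G_law: "map_pmf (\<lambda>w. snd w t) joined = coin b (thin l' b)"
proof -
  have "map_pmf (\<lambda>w. snd w t) joined =
      bind_pmf (pmf_of_set {..<q}) (\<lambda>\<phi>. map_pmf (\<lambda>\<omega>. snd (snd (\<omega> (idx \<phi> t))) t) \<Omega>)"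
    by (simp add: joined_def map_pmf_comp pair_pmf_eq_bind map_bind_pmf case_prod_beta' newG_def)
  also have "\<dots> = bind_pmf (pmf_of_set {..<q}) (\<lambda>\<phi>. coin b (thin l' b))"
  proof (rule bind_pmf_cong[OF refl])
    show "map_pmf (\<lambda>\<omega>. snd (snd (\<omega> (idx \<phi> t))) t) \<Omega> = coin b (thin l' b)" for \<phi>
      using component_law[OF idx_less, of "\<lambda>z. snd (snd z) t" \<phi> t] block_G_law[OF pr l(1,3)] by simp
  qed
  finally show ?thesis by simp
qed

lemma meet_imp_hits:
  assumes "q \<le> n" "n \<le> reach" "meet \<phi> x n \<omega>"
  shows "hits (newF \<phi> \<omega>) (newG \<phi> \<omega>) window x"
proof -
  have "n \<le> spikeF (\<omega> (idx \<phi> (x + n))) (x + n) * spikeG (\<omega> (idx \<phi> (x + 2 * n))) (x + 2 * n)"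
    using assms by (simp add: meet_def)
  also have "\<dots> \<le> newF \<phi> \<omega> (x + n) * newG \<phi> \<omega> (x + 2 * n)"
    by (intro mult_le_mono) (auto simp: spikeF_def spikeG_def newF_def newG_def)
  finally show ?thesis using assms q(1)
    by (auto simp: hits_def window_def intro!: bexI[of _ n])
qed

lemma inner_imp_hits:
  assumes inside: "(x + \<phi>) mod q + 2 * (l' * R) < q"
    and hit: "hits (fst (snd (\<omega> (idx \<phi> x)))) (snd (snd (\<omega> (idx \<phi> x)))) (l' * R) x"
  shows "hits (newF \<phi> \<omega>) (newG \<phi> \<omega>) window x"
proof -
  have same: "idx \<phi> (x + k) = idx \<phi> x" if "k \<le> 2 * (l' * R)" for k
  proof -
    have "x + k + \<phi> = q * ((x + \<phi>) div q) + ((x + \<phi>) mod q + k)" by simp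
    moreover have "(x + \<phi>) mod q + k < q" using inside that by simp
    ultimately have "(x + k + \<phi>) div q = (x + \<phi>) div q" using q(1)
      by (metis add.right_neutral div_less div_mult_self4 less_numeral_extra(3) mult.commute add.commute)
    thus ?thesis by (simp add: idx_def)
  qed
  obtain n where n: "1 \<le> n" "n \<le> l' * R"
    "n \<le> fst (snd (\<omega> (idx \<phi> x))) (x + n) * snd (snd (\<omega> (idx \<phi> x))) (x + 2 * n)"
    using hit by (auto simp: hits_def)
  have "n \<le> newF \<phi> \<omega> (x + n) * newG \<phi> \<omega> (x + 2 * n)"
    using n same[of n] same[of "2 * n"] by (simp add: newF_def newG_def)
  thus ?thesis using n by (auto simp: hits_def window_def intro!: bexI[of _ n])
qed

text \<open>The old hits at \<open>x\<close> are determined by the block of \<open>x\<close>, the new ones by later blocks, so the two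
ways of being hit are independent.\<close>

lemma joined_hits_at_phase:
  assumes small: "80 * (real V)\<^sup>2 * (real q / (real l * real l')) \<le> e\<^sup>2"
    and inside: "(x + \<phi>) mod q + 2 * (l' * R) < q"
  shows "c + (1 - c) * (e\<^sup>2 / 8) \<le>
    measure_pmf.prob \<Omega> {\<omega>. hits (newF \<phi> \<omega>) (newG \<phi> \<omega>) window x}"
proof -
  let ?J = "\<lambda>z :: block. hits (fst (snd z)) (snd (snd z)) (l' * R) x"
  let ?O = "\<lambda>\<omega>. \<exists>n\<in>{q..reach}. meet \<phi> x n \<omega>"
  let ?i = "idx \<phi> x"
  have J: "c \<le> measure_pmf.prob (block l l' p) {z. ?J z}"
    by (rule block_hits[OF pr l(1,3) l(2) c0])
  have O: "e\<^sup>2 / 8 \<le> measure_pmf.prob \<Omega> {\<omega>. ?O \<omega>}" by (rule meet_some_prob[OF small])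
  have compl: "measure_pmf.prob r {z. \<not> P z} = 1 - measure_pmf.prob r {z. P z}" for r :: "'z pmf" and P
    using measure_pmf.prob_compl[of "{z. P z}" r] by (simp add: Compl_eq_Diff_UNIV[symmetric] Collect_neg_eq)
  have "measure_pmf.prob \<Omega> {\<omega>. \<not> ?J (\<omega> ?i) \<and> \<not> ?O \<omega>} =
     measure_pmf.prob (block l l' p) {z. \<not> ?J z} * measure_pmf.prob \<Omega> {\<omega>. \<not> ?O \<omega>}"
  proof (rule \<Omega>_indep1[OF idx_less])
    fix \<omega> \<omega>' :: "nat \<Rightarrow> block"
    assume eq: "\<And>j. j \<noteq> ?i \<Longrightarrow> j < blocks \<Longrightarrow> \<omega> j = \<omega>' j"
    have "meet \<phi> x n \<omega> = meet \<phi> x n \<omega>'" if n: "n \<in> {q..reach}" for n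
    proof -
      have "idx \<phi> x \<noteq> idx \<phi> (x + n)" "idx \<phi> x \<noteq> idx \<phi> (x + 2 * n)"
        using n by (intro idx_neq[of x]; simp add: window_def)+
      thus ?thesis using eq[of "idx \<phi> (x + n)"] eq[of "idx \<phi> (x + 2 * n)"] idx_less
        by (simp add: meet_def)
    qed
    thus "(\<not> ?O \<omega>) = (\<not> ?O \<omega>')" by blast
  qed
  also have "\<dots> = (1 - measure_pmf.prob (block l l' p) {z. ?J z}) * (1 - measure_pmf.prob \<Omega> {\<omega>. ?O \<omega>})"
    by (simp only: compl)
  also have "\<dots> \<le> (1 - c) * (1 - e\<^sup>2 / 8)"
    using J O by (intro mult_mono) (auto intro: order_trans[OF _ measure_pmf.prob_le_1])
  finally have "measure_pmf.prob \<Omega> {\<omega>. \<not> (?J (\<omega> ?i) \<or> ?O \<omega>)} \<le> (1 - c) * (1 - e\<^sup>2 / 8)" by simp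
  hence "c + (1 - c) * (e\<^sup>2 / 8) \<le> measure_pmf.prob \<Omega> {\<omega>. ?J (\<omega> ?i) \<or> ?O \<omega>}"
    unfolding compl by (simp add: algebra_simps)
  also have "\<dots> \<le> measure_pmf.prob \<Omega> {\<omega>. hits (newF \<phi> \<omega>) (newG \<phi> \<omega>) window x}"
    using inner_imp_hits[OF inside] meet_imp_hits
    by (intro measure_pmf.finite_measure_mono) auto
  finally show ?thesis .
qed

text \<open>The subtracted term bounds the probability that a block boundary comes too soon after \<open>x\<close> for the
old hits to survive.\<close>

lemma joined_process:
  assumes small: "80 * (real V)\<^sup>2 * (real q / (real l * real l')) \<le> e\<^sup>2" and c1: "c \<le> 1"
  shows "process joined (coin (thin l a) a) (coin b (thin l' b)) window
    (c + (1 - c) * (e\<^sup>2 / 8) - 2 * real (l' * R) / real q)"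
  unfolding process_def
proof (intro conjI allI joined_F_law joined_G_law)
  fix x
  define \<theta> \<delta> where "\<theta> = c + (1 - c) * (e\<^sup>2 / 8)" and "\<delta> = 2 * real (l' * R) / real q"
  let ?in = "{\<phi>. (x + \<phi>) mod q + 2 * (l' * R) < q}"
  have e2: "e\<^sup>2 \<le> 1" using e by (simp add: power_le_one)
  have \<theta>0: "0 \<le> \<theta>" using c0 c1 by (simp add: \<theta>_def)
  have "(1 - c) * (e\<^sup>2 / 8) \<le> (1 - c) * 1" using c1 e2 by (intro mult_left_mono) auto
  hence \<theta>1: "\<theta> \<le> 1" by (simp add: \<theta>_def)
  have in_ge: "1 - \<delta> \<le> measure_pmf.prob (pmf_of_set {..<q}) ?in"
    using prob_phase_inside[OF q(1), of "2 * (l' * R)" x] by (simp add: \<delta>_def)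
  have "0 \<le> \<delta>" by (simp add: \<delta>_def)
  hence "\<delta> * \<theta> \<le> \<delta>" using \<theta>1 by (simp add: mult_left_le)
  hence "\<theta> - \<delta> \<le> (1 - \<delta>) * \<theta>" by (simp add: algebra_simps)
  also have "\<dots> \<le> measure_pmf.prob (pmf_of_set {..<q}) ?in * \<theta>"
    by (rule mult_right_mono[OF in_ge \<theta>0])
  also have "\<dots> \<le> measure_pmf.prob (pair_pmf (pmf_of_set {..<q}) \<Omega>)
      {w. hits (newF (fst w) (snd w)) (newG (fst w) (snd w)) window x}"
    using joined_hits_at_phase[OF small] \<theta>0
    by (intro prob_pair_pmf_ge) (auto simp: \<theta>_def)
  also have "\<dots> = measure_pmf.prob joined {w. hits (fst w) (snd w) window x}"
    by (simp add: joined_def vimage_def case_prod_beta')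
  finally show "c + (1 - c) * (e\<^sup>2 / 8) - 2 * real (l' * R) / real q
      \<le> measure_pmf.prob joined {w. hits (fst w) (snd w) window x}"
    by (simp add: \<theta>_def \<delta>_def)
qed

end

text \<open>The mean \<open>e\<close> is fixed, while the bound \<open>V\<close> on the values and the length \<open>R\<close> of the hits may be
arbitrarily large; both grow from round to round.\<close>

definition attains :: "real \<Rightarrow> real \<Rightarrow> bool" where
  "attains e c \<longleftrightarrow> (\<exists>p a b R V. process p a b R c \<and> set_pmf a \<subseteq> {..V} \<and> set_pmf b \<subseteq> {..V} \<and>
     measure_pmf.expectation a real = e \<and> measure_pmf.expectation b real = e)"

lemma process_mono: "process p a b R c \<Longrightarrow> c' \<le> c \<Longrightarrow> process p a b R c'"
  unfolding process_def by (meson order_trans)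

lemma attains_mono: "attains e c \<Longrightarrow> c' \<le> c \<Longrightarrow> attains e c'"
  unfolding attains_def using process_mono by blast

lemma attains_zero:
  assumes "0 \<le> e" "e \<le> 1"
  shows "attains e 0"
proof -
  let ?a = "map_pmf (\<lambda>h. if h then 1 else 0 :: nat) (bernoulli_pmf e)"
  let ?p = "map_pmf (\<lambda>h. (\<lambda>t :: nat. if h then 1 else 0 :: nat, \<lambda>t :: nat. if h then 1 else 0 :: nat)) (bernoulli_pmf e)"
  have "process ?p ?a ?a 0 0" by (simp add: process_def map_pmf_comp)
  moreover have "set_pmf ?a \<subseteq> {..1}" by auto
  moreover have "measure_pmf.expectation ?a real = e" using assms by simp
  ultimately show ?thesis unfolding attains_def by blast
qed

text \<open>As long as \<open>c \<le> 1 / 2\<close>, a round gains at least \<open>e\<^sup>2 / 16\<close> from new hits. The block length is chosen so that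
boundary effects cost at most half of this.\<close>

lemma attains_step:
  assumes at: "attains e c" and c: "0 \<le> c" "c \<le> 1 / 2" and e: "0 < e" "e \<le> 1"
  shows "attains e (c + e\<^sup>2 / 32)"
proof -
  obtain p a b R V0 where pr: "process p a b R c" and V0: "set_pmf a \<subseteq> {..V0}" "set_pmf b \<subseteq> {..V0}"
    and mean: "measure_pmf.expectation a real = e" "measure_pmf.expectation b real = e"
    using at by (auto simp: attains_def)
  define V where "V = V0 + 1"
  have V: "set_pmf a \<subseteq> {..V}" "set_pmf b \<subseteq> {..V}" "1 \<le> V" using V0 by (auto simp: V_def)
  have e2: "0 < e\<^sup>2" using e by simp
  \<comment> \<open>\<open>M\<close> is the number of \<open>F\<close>-cells in a block. It is large against \<open>R\<close>, so that few positions are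
    close to a boundary; the scale \<open>k\<close> is then chosen large against \<open>M * V\<^sup>2\<close>.\<close>
  define M where "M = nat \<lceil>128 * real R / e\<^sup>2\<rceil> + 1"
  define k where "k = nat \<lceil>80 * (real V)\<^sup>2 * real M / e\<^sup>2\<rceil> + M"
  define l l' where "l = 2 * k" and "l' = 2 * k + 1"
  have M: "1 \<le> M" "128 * real R / e\<^sup>2 \<le> real M" unfolding M_def by linarith+
  have k: "M \<le> k" "80 * (real V)\<^sup>2 * real M / e\<^sup>2 \<le> real k" unfolding k_def by linarith+
  have l: "0 < l" "l \<le> l'" "odd l'" "coprime l l'" using M k by (auto simp: l_def l'_def)
  have "M \<le> l'" using k by (simp add: l'_def)
  hence q: "0 < l * M" "l * M \<le> l * l'" using l M by auto
  interpret spreading p a b R V l l' "l * M" c e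
    using pr c V mean e l q by unfold_locales auto
  have "80 * (real V)\<^sup>2 * real M \<le> e\<^sup>2 * real k" using k(2) e2 by (simp add: field_simps)
  also have "\<dots> \<le> e\<^sup>2 * real l'" using e2 by (intro mult_left_mono) (auto simp: l'_def)
  finally have "80 * (real V)\<^sup>2 * (real M / real l') \<le> e\<^sup>2"
    using l'_pos by (simp add: field_simps)
  moreover have "real (l * M) / (real l * real l') = real M / real l'" using l by simp
  ultimately have small: "80 * (real V)\<^sup>2 * (real (l * M) / (real l * real l')) \<le> e\<^sup>2" by simp
  have "2 * real (l' * R) / real (l * M) \<le> 4 * real R / real M"
  proof -
    have "real l' \<le> 2 * real l" using l by (simp add: l_def l'_def)
    hence "real l' * real R \<le> 2 * real l * real R" by (intro mult_right_mono) auto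
    thus ?thesis using l M by (simp add: field_simps)
  qed
  also have "\<dots> \<le> e\<^sup>2 / 32" using M e2 by (simp add: field_simps)
  finally have "2 * real (l' * R) / real (l * M) \<le> e\<^sup>2 / 32" .
  moreover have "(1 / 2) * (e\<^sup>2 / 8) \<le> (1 - c) * (e\<^sup>2 / 8)" using c e2 by (intro mult_right_mono) auto
  ultimately have gain: "c + e\<^sup>2 / 32 \<le> c + (1 - c) * (e\<^sup>2 / 8) - 2 * real (l' * R) / real (l * M)"
    by simp
  have "V \<le> l' * V" "l * V \<le> l' * V" using l mult_le_mono1[of 1 l' V] mult_le_mono1[of l l' V]
    by (simp_all add: l'_def)
  note le = this
  have "x \<le> l' * V" if "x \<in> set_pmf (coin (thin l a) a)" for x
    using that thin_le[OF V(1), of x l] V(1)[THEN subsetD, of x]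
    by (auto simp: set_pmf_coin intro: order_trans[OF _ le(1)] order_trans[OF _ le(2)])
  moreover have "x \<le> l' * V" if "x \<in> set_pmf (coin b (thin l' b))" for x
    using that thin_le[OF V(2), of x l'] V(2)[THEN subsetD, of x]
    by (auto simp: set_pmf_coin intro: order_trans[OF _ le(1)])
  ultimately have bound: "set_pmf (coin (thin l a) a) \<subseteq> {..l' * V}"
    "set_pmf (coin b (thin l' b)) \<subseteq> {..l' * V}" by auto
  have "attains e (c + (1 - c) * (e\<^sup>2 / 8) - 2 * real (l' * R) / real (l * M))"
    unfolding attains_def
  proof (intro exI conjI)
    show "process joined (coin (thin l a) a) (coin b (thin l' b)) window
      (c + (1 - c) * (e\<^sup>2 / 8) - 2 * real (l' * R) / real (l * M))"
      using c by (intro joined_process small) simp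
    show "measure_pmf.expectation (coin (thin l a) a) real = e"
      by (simp add: mean_coin finite_laws mean_thin l mean)
    show "measure_pmf.expectation (coin b (thin l' b)) real = e"
      by (simp add: mean_coin finite_laws mean_thin l'_pos mean)
  qed (rule bound)+
  thus ?thesis using gain by (rule attains_mono)
qed

lemma attains_half:
  assumes e: "0 < e" "e \<le> 1"
  shows "attains e (1 / 2)"
proof -
  have "attains e (min (1 / 2) (real k * (e\<^sup>2 / 32)))" for k
  proof (induction k)
    case 0
    thus ?case using attains_zero[of e] e by simp
  next
    case (Suc k)
    let ?c = "min (1 / 2) (real k * (e\<^sup>2 / 32))"
    have "attains e (?c + e\<^sup>2 / 32)" using Suc e by (intro attains_step) auto
    moreover have "min (1 / 2) (real (Suc k) * (e\<^sup>2 / 32)) \<le> ?c + e\<^sup>2 / 32"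
    proof -
      have "real (Suc k) * (e\<^sup>2 / 32) = real k * (e\<^sup>2 / 32) + e\<^sup>2 / 32"
        by (simp add: algebra_simps)
      moreover have "0 \<le> e\<^sup>2 / 32" by simp
      ultimately show ?thesis by linarith
    qed
    ultimately show ?case by (rule attains_mono)
  qed
  moreover obtain k :: nat where "1 / 2 \<le> real k * (e\<^sup>2 / 32)"
    using reals_Archimedean3[of "e\<^sup>2 / 32"] e by (metis less_eq_real_def zero_less_divide_iff zero_less_numeral zero_less_power)
  ultimately show ?thesis by (metis min.absorb1)
qed

section \<open>A deterministic pattern\<close>

text \<open>An averaging argument over the random pair: a sample is selected for which the number of hits is
large and the two sums are small simultaneously.\<close>

lemma exists_pattern:
  assumes e: "0 < e" "e \<le> 1"
  obtains N and F G :: "nat \<Rightarrow> nat" where "0 < N"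
    "real (\<Sum>t<N. F t) \<le> 16 * e * real N" "real (\<Sum>t<N. G t) \<le> 16 * e * real N"
    "real N / 16 \<le> real (card {t. t < N \<and> (\<exists>n\<ge>1. t + 2 * n < N \<and> n \<le> F (t + n) * G (t + 2 * n))})"
proof -
  obtain p a b R V where pr: "process p a b R (1 / 2)" and V: "set_pmf a \<subseteq> {..V}" "set_pmf b \<subseteq> {..V}"
    and mean: "measure_pmf.expectation a real = e" "measure_pmf.expectation b real = e"
    using attains_half[OF e] by (auto simp: attains_def)
  define h where "h = R + 1"
  define N where "N = 4 * h"
  have N0: "0 < real N" by (simp add: N_def h_def)
  let ?cov = "\<lambda>w. real (card {t. t < N \<and> (\<exists>n\<ge>1. t + 2 * n < N \<and> n \<le> fst w (t + n) * snd w (t + 2 * n))})"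
  let ?H = "\<lambda>t. {w. hits (fst w) (snd w) R t}"
  have fin: "finite (set_pmf a)" "finite (set_pmf b)" using V finite_subset by auto
  have F: "map_pmf (\<lambda>w. fst w t) p = a" and G: "map_pmf (\<lambda>w. snd w t) p = b"
    and H: "1 / 2 \<le> measure_pmf.prob p (?H t)" for t
    using pr by (auto simp: process_def)
  have mF: "measure_pmf.expectation p (\<lambda>w. real (fst w t)) = e" for t
    using mean(1) by (subst (asm) F[of t, symmetric]) simp
  have mG: "measure_pmf.expectation p (\<lambda>w. real (snd w t)) = e" for t
    using mean(2) by (subst (asm) G[of t, symmetric]) simp
  have iF: "integrable p (\<lambda>w. real (fst w t))" for t
    using integrable_measure_pmf_finite[OF fin(1), of real]
    by (subst (asm) F[of t, symmetric]) (simp add: integrable_map_pmf_eq)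
  have iG: "integrable p (\<lambda>w. real (snd w t))" for t
    using integrable_measure_pmf_finite[OF fin(2), of real]
    by (subst (asm) G[of t, symmetric]) (simp add: integrable_map_pmf_eq)
  have iH: "integrable p (\<lambda>w. indicator (?H t) w :: real)" for t
    by (intro measure_pmf.integrable_const_bound[where B=1]) auto
  \<comment> \<open>Only positions in the first half of \<open>{..<N}\<close> are counted, so that hits end before \<open>N\<close>. With
    the divisor \<open>16 * e\<close> the penalty has mean \<open>N / 8\<close>, half of a lower bound for the expected number of hits.\<close>
  define \<Phi> where "\<Phi> w = (\<Sum>t<2 * h. indicator (?H t) w) -
    ((\<Sum>t<N. real (fst w t)) + (\<Sum>t<N. real (snd w t))) / (16 * e)" for w
  have "measure_pmf.expectation p \<Phi> = (\<Sum>t<2 * h. measure_pmf.prob p (?H t)) -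
      ((\<Sum>t<N. e) + (\<Sum>t<N. e)) / (16 * e)"
    unfolding \<Phi>_def using iF iG iH by (simp add: mF mG)
  also have "\<dots> \<ge> (\<Sum>t<2 * h. 1 / 2) - ((\<Sum>t<N. e) + (\<Sum>t<N. e)) / (16 * e)"
    by (intro diff_right_mono sum_mono H)
  also have "(\<Sum>t<2 * h. 1 / 2) - ((\<Sum>t<N. e) + (\<Sum>t<N. e)) / (16 * e) = real N / 8"
    using e by (simp add: N_def field_simps)
  finally have E: "real N / 8 \<le> measure_pmf.expectation p \<Phi>" .
  have "\<exists>w\<in>set_pmf p. real N / 16 \<le> \<Phi> w"
  proof (rule ccontr)
    assume "\<not> ?thesis"
    hence "AE w in p. \<Phi> w \<le> real N / 16" by (auto simp: AE_measure_pmf_iff not_le)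
    moreover have "integrable p \<Phi>" unfolding \<Phi>_def using iF iG iH by auto
    ultimately have "measure_pmf.expectation p \<Phi> \<le> real N / 16"
      using integral_mono_AE[of p \<Phi> "\<lambda>_. real N / 16"] by simp
    thus False using E N0 by simp
  qed
  then obtain w where w: "real N / 16 \<le> \<Phi> w" by blast
  have cnt: "(\<Sum>t<2 * h. indicator (?H t) w) = real (card {t. t < 2 * h \<and> hits (fst w) (snd w) R t})"
    by (simp add: indicator_def of_bool_def[symmetric] Int_def)
  also have "\<dots> \<le> ?cov w"
  proof -
    have "{t. t < 2 * h \<and> hits (fst w) (snd w) R t} \<subseteq>
      {t. t < N \<and> (\<exists>n\<ge>1. t + 2 * n < N \<and> n \<le> fst w (t + n) * snd w (t + 2 * n))}"
      by (fastforce simp: hits_def N_def h_def)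
    thus ?thesis by (intro of_nat_mono card_mono) auto
  qed
  finally have "(\<Sum>t<2 * h. indicator (?H t) w) \<le> ?cov w" .
  moreover have "(\<Sum>t<2 * h. indicator (?H t) w) \<le> real N"
  proof -
    have "card {t. t < 2 * h \<and> hits (fst w) (snd w) R t} \<le> card {..<N}"
      by (intro card_mono) (auto simp: N_def)
    thus ?thesis unfolding cnt by simp
  qed
  moreover have nn: "0 \<le> (\<Sum>t<N. real (fst w t))" "0 \<le> (\<Sum>t<N. real (snd w t))"
    by (auto intro: sum_nonneg)
  hence "0 \<le> ((\<Sum>t<N. real (fst w t)) + (\<Sum>t<N. real (snd w t))) / (16 * e)" using e by simp
  ultimately have 1: "real N / 16 \<le> ?cov w"
    and 2: "((\<Sum>t<N. real (fst w t)) + (\<Sum>t<N. real (snd w t))) / (16 * e) \<le> real N"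
    using w N0 unfolding \<Phi>_def by linarith+
  have "(\<Sum>t<N. real (fst w t)) + (\<Sum>t<N. real (snd w t)) \<le> 16 * e * real N"
    using 2 e by (simp add: field_simps)
  hence "real (\<Sum>t<N. fst w t) \<le> 16 * e * real N" "real (\<Sum>t<N. snd w t) \<le> 16 * e * real N"
    using nn by simp_all
  with 1 N0 show ?thesis by (intro that[of N "fst w" "snd w"]) auto
qed

section \<open>Transport to an ergodic system\<close>

text \<open>A set of positive measure that is not an atom splits into two parts of positive measure, and one
of them has at most half of the measure. This is iterated from the whole space.\<close>

lemma (in prob_space) nonatomic_small_set:
  assumes na: "nonatomic M" and "0 < \<delta>"
  obtains A where "A \<in> events" "0 < prob A" "prob A < \<delta>"
proof -
  have half: "\<exists>B\<in>events. 0 < prob B \<and> prob B \<le> prob A / 2" if A: "A \<in> events" "0 < prob A" for A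
  proof -
    have "\<not> measure_atom M A" using na by (simp add: nonatomic_def)
    then obtain B where B: "B \<in> events" "B \<subseteq> A" "emeasure M B < emeasure M A" "emeasure M B \<noteq> 0"
      using A by (auto simp: measure_atom_def emeasure_eq_measure)
    have pB: "0 < prob B" "prob B < prob A"
      using B by (auto simp: emeasure_eq_measure ennreal_less_iff zero_less_measure_iff)
    have "prob (A - B) = prob A - prob B" using A B by (intro finite_measure_Diff)
    show ?thesis
    proof (cases "prob B \<le> prob A / 2")
      case True
      thus ?thesis using B pB by blast
    next
      case False
      thus ?thesis using A B pB \<open>prob (A - B) = _\<close> by (intro bexI[of _ "A - B"]) auto
    qed
  qed
  have "\<exists>A\<in>events. 0 < prob A \<and> prob A \<le> (1 / 2) ^ k" for k
  proof (induction k)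
    case 0 show ?case by (intro bexI[of _ "space M"]) (auto simp: prob_space)
  next
    case (Suc k)
    then obtain A where A: "A \<in> events" "0 < prob A" "prob A \<le> (1 / 2) ^ k" by blast
    from half[OF A(1,2)] obtain B where "B \<in> events" "0 < prob B" "prob B \<le> prob A / 2" by blast
    thus ?case using A by (intro bexI[of _ B]) auto
  qed
  moreover obtain k where "(1 / 2 :: real) ^ k < \<delta>" using real_arch_pow_inv[OF assms(2), of "1 / 2"] by auto
  ultimately show ?thesis using that by (meson le_less_trans)
qed

lemma mod_Suc_less:
  fixes m n j :: nat
  assumes "m mod n = j" "Suc j < n"
  shows "Suc m mod n = Suc j"
  using assms by (simp add: mod_Suc)

locale mp_system = prob_space +
  fixes T :: "'a \<Rightarrow> 'a"
  assumes mp: "measure_preserving M T"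
begin

lemma T_measurable [measurable]: "T \<in> measurable M M"
  using mp by (simp add: measure_preserving_def)

lemma T_space: "x \<in> space M \<Longrightarrow> T x \<in> space M"
  using measurable_space[OF T_measurable] .

lemma funpow_measurable [measurable]: "(T ^^ n) \<in> measurable M M"
  by (rule measurable_compose_n[OF T_measurable])

lemma funpow_space: "x \<in> space M \<Longrightarrow> (T ^^ n) x \<in> space M"
  using measurable_space[OF funpow_measurable] .

lemma emeasure_preimage: "A \<in> events \<Longrightarrow> emeasure M (T -` A \<inter> space M) = emeasure M A"
  using mp by (simp add: measure_preserving_def)

lemma emeasure_funpow_preimage:
  assumes "A \<in> events"
  shows "emeasure M ((T ^^ n) -` A \<inter> space M) = emeasure M A"
proof (induction n)
  case 0 show ?case using sets.sets_into_space[OF assms] by (simp add: Int_absorb2)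
next
  case (Suc n)
  have "(T ^^ Suc n) -` A \<inter> space M = T -` ((T ^^ n) -` A \<inter> space M) \<inter> space M"
    by (auto simp: funpow_swap1 T_space)
  also have "emeasure M \<dots> = emeasure M ((T ^^ n) -` A \<inter> space M)"
    using assms by (intro emeasure_preimage) measurable
  finally show ?case by (simp only: Suc)
qed

lemma AE_orbit:
  assumes "AE x in M. P x"
  shows "AE x in M. \<forall>n. P ((T ^^ n) x)"
proof -
  obtain N where N: "{x \<in> space M. \<not> P x} \<subseteq> N" "emeasure M N = 0" "N \<in> events"
    using assms by (auto elim: AE_E)
  have "AE x in M. P ((T ^^ n) x)" for n
  proof (rule AE_I')
    show "(T ^^ n) -` N \<inter> space M \<in> null_sets M"
      using N emeasure_funpow_preimage[of N n] by (intro null_setsI) auto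
    show "{x \<in> space M. \<not> P ((T ^^ n) x)} \<subseteq> (T ^^ n) -` N \<inter> space M"
      using N(1) funpow_space by blast
  qed
  thus ?thesis by (simp add: AE_all_countable)
qed

text \<open>The points that visit \<open>A\<close> only finitely often form an invariant set \<open>U\<close>. It is the increasing union
of sets \<open>W k\<close> disjoint from the preimage of \<open>A\<close> under \<open>T ^^ k\<close>, so its measure is at most
\<open>1 - prob A\<close>. By ergodicity it is null.\<close>

lemma AE_visits:
  assumes erg: "ergodic M T" and A: "A \<in> events" "0 < prob A"
  shows "AE x in M. \<exists>n. (T ^^ n) x \<in> A"
proof -
  define W where "W k = {x \<in> space M. \<forall>n\<ge>k. (T ^^ n) x \<notin> A}" for k
  define U where "U = (\<Union>k. W k)"
  have W_sets: "W k \<in> events" for k unfolding W_def using A by measurable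
  have U_sets: "U \<in> events" unfolding U_def using W_sets by auto
  have shift: "(\<exists>k. \<forall>n\<ge>k. (T ^^ n) (T x) \<notin> A) \<longleftrightarrow> (\<exists>k. \<forall>n\<ge>k. (T ^^ n) x \<notin> A)" for x
  proof
    assume "\<exists>k. \<forall>n\<ge>k. (T ^^ n) (T x) \<notin> A"
    then obtain k where k: "\<And>n. k \<le> n \<Longrightarrow> (T ^^ Suc n) x \<notin> A" by (auto simp: funpow_swap1)
    have "(T ^^ n) x \<notin> A" if "Suc k \<le> n" for n using k[of "n - 1"] that by (cases n) auto
    thus "\<exists>k. \<forall>n\<ge>k. (T ^^ n) x \<notin> A" by blast
  next
    assume "\<exists>k. \<forall>n\<ge>k. (T ^^ n) x \<notin> A"
    then obtain k where k: "\<And>n. k \<le> n \<Longrightarrow> (T ^^ n) x \<notin> A" by blast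
    have "(T ^^ n) (T x) \<notin> A" if "k \<le> n" for n using k[of "Suc n"] that by (simp add: funpow_swap1)
    thus "\<exists>k. \<forall>n\<ge>k. (T ^^ n) (T x) \<notin> A" by blast
  qed
  have U_iff: "x \<in> U \<longleftrightarrow> x \<in> space M \<and> (\<exists>k. \<forall>n\<ge>k. (T ^^ n) x \<notin> A)" for x
    by (auto simp: U_def W_def)
  have "x \<in> T -` U \<inter> space M \<longleftrightarrow> x \<in> U" for x
    unfolding Int_iff vimage_eq U_iff shift using T_space by blast
  hence "T -` U \<inter> space M = U" by blast
  hence inv: "emeasure M U = 0 \<or> emeasure M (space M - U) = 0"
    using erg U_sets by (auto simp: ergodic_def)
  have "incseq W" by (auto simp: W_def incseq_def)
  hence lim: "(\<lambda>k. prob (W k)) \<longlonglongrightarrow> prob U"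
    unfolding U_def using W_sets by (intro finite_Lim_measure_incseq) auto
  have "prob (W k) \<le> 1 - prob A" for k
  proof -
    let ?V = "(T ^^ k) -` A \<inter> space M"
    have V: "?V \<in> events" using A by measurable
    have "prob (W k) \<le> prob (space M - ?V)"
      using V by (intro finite_measure_mono) (auto simp: W_def)
    also have "\<dots> = 1 - prob ?V" using V by (rule prob_compl)
    also have "prob ?V = prob A" using emeasure_funpow_preimage[OF A(1), of k] by (simp add: measure_def)
    finally show ?thesis .
  qed
  hence "prob U \<le> 1 - prob A" by (intro LIMSEQ_le_const2[OF lim]) auto
  hence "prob (space M - U) > 0" using A prob_compl[OF U_sets] by simp
  hence "emeasure M U = 0" using inv by (auto simp: emeasure_eq_measure)
  hence "AE x in M. x \<notin> U" using U_sets by (intro AE_not_in) auto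
  thus ?thesis
  proof (rule AE_mp, intro AE_I2 impI)
    fix x assume "x \<in> space M" "x \<notin> U"
    thus "\<exists>n. (T ^^ n) x \<in> A" by (auto simp: U_def W_def)
  qed
qed

text \<open>Towers for a map that need not be invertible. Take a set \<open>A\<close> of tiny measure and sort the points by the
time of their first visit to \<open>A\<close>, modulo \<open>N\<close>. The map lowers this time by one, as long as it is not zero; so
it permutes the levels cyclically except on \<open>A\<close>, and their measures differ by at
most \<open>N * prob A\<close>.\<close>

lemma tower:
  assumes erg: "ergodic M T" and na: "nonatomic M" and N: "0 < N"
  obtains P :: "nat \<Rightarrow> 'a set" where "\<And>i. P i \<in> events" "disjoint_family_on P {..<N}"
    "\<And>i x. Suc i < N \<Longrightarrow> x \<in> P i \<Longrightarrow> T x \<in> P (Suc i)"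
    "\<And>i. i < N \<Longrightarrow> 1 / (2 * real N) \<le> prob (P i)" "\<And>i. i < N \<Longrightarrow> prob (P i) \<le> 2 / real N"
proof -
  obtain A where A: "A \<in> events" "0 < prob A" "prob A < 1 / (2 * real N * real N)"
    using nonatomic_small_set[OF na, of "1 / (2 * real N * real N)"] N by auto
  define first where "first m x \<longleftrightarrow> (T ^^ m) x \<in> A \<and> (\<forall>i<m. (T ^^ i) x \<notin> A)" for m x
  define L where "L j = {x \<in> space M. \<exists>m. m mod N = j \<and> first m x}" for j
  have L_sets: "L j \<in> events" for j unfolding L_def first_def using A by measurable
  have first_unique: "m = m'" if fm: "first m x" "first m' x" for m m' x
  proof -
    have "\<not> m < m'" using fm unfolding first_def by blast
    moreover have "\<not> m' < m" using fm unfolding first_def by blast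
    ultimately show ?thesis by simp
  qed
  have L_disj: "L i \<inter> L j = {}" if "i \<noteq> j" for i j
  proof -
    have False if xij: "x \<in> L i" "x \<in> L j" for x
    proof -
      obtain m m' where m: "m mod N = i" "first m x" "m' mod N = j" "first m' x"
        using xij by (auto simp: L_def)
      thus False using first_unique[of m x m'] \<open>i \<noteq> j\<close> by simp
    qed
    thus ?thesis by blast
  qed
  have L_step: "T x \<in> L j" if x: "x \<in> L (Suc j)" and j: "Suc j < N" for x j
  proof -
    obtain m where m: "m mod N = Suc j" "first m x" using x by (auto simp: L_def)
    then obtain m' where m': "m = Suc m'" by (cases m) auto
    have "m' mod N = j" using m(1) unfolding m' by (auto simp: mod_Suc split: if_splits)
    moreover have "first m' (T x)"
      unfolding first_def
    proof (intro conjI allI impI)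
      show "(T ^^ m') (T x) \<in> A" using m(2) by (simp add: first_def m' funpow_swap1)
      show "(T ^^ i) (T x) \<notin> A" if "i < m'" for i
      proof -
        have "(T ^^ Suc i) x \<notin> A" using m(2) that unfolding first_def m' by blast
        thus ?thesis by (simp add: funpow_swap1)
      qed
    qed
    ultimately show ?thesis using x T_space by (auto simp: L_def)
  qed
  have L_back: "T -` L j \<inter> space M \<subseteq> L (Suc j) \<union> A" if j: "Suc j < N" for j
  proof
    fix x assume x: "x \<in> T -` L j \<inter> space M"
    then obtain m where m: "m mod N = j" "first m (T x)" by (auto simp: L_def)
    show "x \<in> L (Suc j) \<union> A"
    proof (cases "x \<in> A")
      case False
      have "(T ^^ i) x \<notin> A" if "i < Suc m" for i
        using that m(2) False by (cases i) (auto simp: first_def funpow_swap1)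
      hence "first (Suc m) x" using m(2) by (auto simp: first_def funpow_swap1)
      thus ?thesis using x mod_Suc_less[OF m(1) j] by (auto simp: L_def)
    qed simp
  qed
  have TL_sets: "T -` L j \<inter> space M \<in> events" for j using L_sets by measurable
  have TL: "prob (T -` L j \<inter> space M) = prob (L j)" for j
    using emeasure_preimage[OF L_sets, of j] by (simp add: measure_def)
  have mono1: "prob (L (Suc j)) \<le> prob (L j)" if "Suc j < N" for j
  proof -
    have "prob (L (Suc j)) \<le> prob (T -` L j \<inter> space M)"
      using L_step that by (intro finite_measure_mono TL_sets) (auto simp: L_def)
    thus ?thesis by (simp add: TL)
  qed
  have near1: "prob (L j) \<le> prob (L (Suc j)) + prob A" if "Suc j < N" for j
  proof -
    have "prob (T -` L j \<inter> space M) \<le> prob (L (Suc j) \<union> A)"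
      using L_back[OF that] L_sets A by (intro finite_measure_mono) auto
    also have "\<dots> \<le> prob (L (Suc j)) + prob A" using L_sets A by (intro measure_Un_le)
    finally show ?thesis by (simp add: TL)
  qed
  have mono: "j < N \<Longrightarrow> i \<le> j \<Longrightarrow> prob (L j) \<le> prob (L i)" for i j
  proof (induction j)
    case (Suc j)
    show ?case
    proof (cases "i = Suc j")
      case False
      hence "prob (L j) \<le> prob (L i)" using Suc by simp
      thus ?thesis using mono1[OF Suc.prems(1)] by simp
    qed simp
  qed simp
  have near: "j < N \<Longrightarrow> prob (L 0) \<le> prob (L j) + real j * prob A" for j
  proof (induction j)
    case (Suc j)
    thus ?case using near1[of j] by (simp add: algebra_simps)
  qed simp
  have near': "prob (L 0) \<le> prob (L j) + 1 / (2 * real N)" if "j < N" for j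
  proof -
    have "real j * prob A \<le> real N * (1 / (2 * real N * real N))"
      using that A by (intro mult_mono) auto
    also have "\<dots> = 1 / (2 * real N)" using N by simp
    finally show ?thesis using near[OF that] by simp
  qed
  have total: "(\<Sum>j<N. prob (L j)) = 1"
  proof -
    have "(\<Sum>j<N. prob (L j)) = prob (\<Union>j<N. L j)"
      using L_sets L_disj by (intro finite_measure_finite_Union[symmetric]) (auto simp: disjoint_family_on_def)
    also have "\<dots> = 1"
    proof (rule prob_eq_1[THEN iffD2])
      show "(\<Union>j<N. L j) \<in> events" using L_sets by auto
      show "AE x in M. x \<in> (\<Union>j<N. L j)" using AE_visits[OF erg A(1,2)]
      proof (rule AE_mp, intro AE_I2 impI)
        fix x assume x: "x \<in> space M" "\<exists>n. (T ^^ n) x \<in> A"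
        define m where "m = (LEAST n. (T ^^ n) x \<in> A)"
        have "first m x" using x(2) unfolding first_def m_def by (auto intro: LeastI_ex dest: not_less_Least)
        thus "x \<in> (\<Union>j<N. L j)" using x N by (auto simp: L_def intro!: bexI[of _ "m mod N"])
      qed
    qed
    finally show ?thesis .
  qed
  have top: "1 / real N \<le> prob (L 0)"
  proof -
    have "(\<Sum>j<N. prob (L j)) \<le> (\<Sum>j<N. prob (L 0))" by (intro sum_mono mono) auto
    thus ?thesis using total N by (simp add: field_simps)
  qed
  have bot: "prob (L (N - 1)) \<le> 1 / real N"
  proof -
    have "(\<Sum>j<N. prob (L (N - 1))) \<le> (\<Sum>j<N. prob (L j))" using N by (intro sum_mono mono) auto
    thus ?thesis using total N by (simp add: field_simps)
  qed
  show ?thesis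
    \<comment> \<open>Times until the visit decrease along orbits, so the levels are numbered backwards.\<close>
  proof (rule that[of "\<lambda>i. L (N - 1 - i)"])
    show "disjoint_family_on (\<lambda>i. L (N - 1 - i)) {..<N}"
      unfolding disjoint_family_on_def by (intro ballI impI L_disj) auto
    show "T x \<in> L (N - 1 - Suc i)" if "Suc i < N" "x \<in> L (N - 1 - i)" for i x
    proof -
      have "N - 1 - i = Suc (N - 1 - Suc i)" using that by simp
      thus ?thesis using that by (intro L_step) auto
    qed
    show "1 / (2 * real N) \<le> prob (L (N - 1 - i))" if "i < N" for i
      using near'[of "N - 1 - i"] top N that by (simp add: field_simps)
    show "prob (L (N - 1 - i)) \<le> 2 / real N" if "i < N" for i
    proof -
      have "prob (L (N - 1 - i)) \<le> prob (L 0)" using N by (intro mono) auto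
      also have "\<dots> \<le> 1 / real N + 1 / (2 * real N)" using near'[of "N - 1"] bot N by simp
      also have "\<dots> \<le> 2 / real N" using N by (simp add: field_simps)
      finally show ?thesis .
    qed
  qed (rule L_sets)
qed

text \<open>The pattern is copied onto the levels of a tower. A position \<open>t\<close> that is hit within the pattern makes
every point of level \<open>t\<close> hit along its orbit, because \<open>t + 2 * n < N\<close> keeps the orbit inside the
tower.\<close>

lemma pattern_functions:
  assumes erg: "ergodic M T" and na: "nonatomic M" and e: "0 < e" "e \<le> 1"
  obtains f g :: "'a \<Rightarrow> real" and D where
    "integrable M f" "\<And>x. 0 \<le> f x" "expectation f \<le> 32 * e"
    "integrable M g" "\<And>x. 0 \<le> g x" "expectation g \<le> 32 * e"
    "D \<in> events" "1 / 32 \<le> prob D"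
    "\<And>x. x \<in> D \<Longrightarrow> \<exists>n\<ge>1. real n \<le> f ((T ^^ n) x) * g ((T ^^ (2 * n)) x)"
proof -
  obtain N and F G :: "nat \<Rightarrow> nat" where N: "0 < N"
    and FG: "real (\<Sum>t<N. F t) \<le> 16 * e * real N" "real (\<Sum>t<N. G t) \<le> 16 * e * real N"
    and cov: "real N / 16 \<le> real (card {t. t < N \<and> (\<exists>n\<ge>1. t + 2 * n < N \<and> n \<le> F (t + n) * G (t + 2 * n))})"
    by (rule exists_pattern[OF e]) blast
  let ?C = "{t. t < N \<and> (\<exists>n\<ge>1. t + 2 * n < N \<and> n \<le> F (t + n) * G (t + 2 * n))}"
  obtain P where P: "\<And>i. P i \<in> events" "disjoint_family_on P {..<N}"
    and step: "\<And>i x. Suc i < N \<Longrightarrow> x \<in> P i \<Longrightarrow> T x \<in> P (Suc i)"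
    and P_ge: "\<And>i. i < N \<Longrightarrow> 1 / (2 * real N) \<le> prob (P i)"
    and P_le: "\<And>i. i < N \<Longrightarrow> prob (P i) \<le> 2 / real N"
    by (rule tower[OF erg na N]) blast
  define lift where "lift H x = (\<Sum>i<N. real (H i) * indicator (P i) x)" for H :: "nat \<Rightarrow> nat" and x
  have lift_int: "integrable M (lift H)" for H
    unfolding lift_def using P by (intro Bochner_Integration.integrable_sum integrable_mult_right) 
      (auto simp: emeasure_eq_measure)
  have lift_nonneg: "0 \<le> lift H x" for H x unfolding lift_def by (intro sum_nonneg) auto
  have lift_exp: "expectation (lift H) \<le> 32 * e" if "real (\<Sum>t<N. H t) \<le> 16 * e * real N" for H
  proof -
    have "expectation (lift H) = (\<Sum>i<N. real (H i) * prob (P i))"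
      unfolding lift_def using P by (subst Bochner_Integration.integral_sum) (auto simp: emeasure_eq_measure)
    also have "\<dots> \<le> (\<Sum>i<N. real (H i) * (2 / real N))"
      by (intro sum_mono mult_left_mono P_le) auto
    also have "\<dots> = real (\<Sum>t<N. H t) * (2 / real N)" by (simp add: sum_distrib_right sum_divide_distrib)
    also have "\<dots> \<le> 16 * e * real N * (2 / real N)" using that by (intro mult_right_mono) auto
    finally show ?thesis using N by simp
  qed
  have lift_eq: "lift H x = real (H i)" if "x \<in> P i" "i < N" for H x i
  proof -
    have "x \<notin> P j" if "j < N" "j \<noteq> i" for j
      using P(2) \<open>x \<in> P i\<close> \<open>i < N\<close> that by (auto simp: disjoint_family_on_def)
    hence "lift H x = (\<Sum>j<N. if j = i then real (H i) else 0)"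
      unfolding lift_def using that(1) by (intro sum.cong) (auto simp: indicator_def)
    thus ?thesis using that by simp
  qed
  have orbit: "i + n < N \<Longrightarrow> x \<in> P i \<Longrightarrow> (T ^^ n) x \<in> P (i + n)" for i n x
    by (induction n) (auto intro: step)
  show ?thesis
  proof (rule that[of "lift F" "lift G" "\<Union>t\<in>?C. P t"])
    show "(\<Union>t\<in>?C. P t) \<in> events" using P by auto
    have "1 / 32 = real N / 16 * (1 / (2 * real N))" using N by simp
    also have "\<dots> \<le> real (card ?C) * (1 / (2 * real N))" using cov by (intro mult_right_mono) auto
    also have "\<dots> = (\<Sum>t\<in>?C. 1 / (2 * real N))" by simp
    also have "\<dots> \<le> (\<Sum>t\<in>?C. prob (P t))" by (intro sum_mono P_ge) auto
    also have "\<dots> = prob (\<Union>t\<in>?C. P t)"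
      using P by (intro finite_measure_finite_Union[symmetric])
        (auto intro: disjoint_family_on_mono[of _ "{..<N}"])
    finally show "1 / 32 \<le> prob (\<Union>t\<in>?C. P t)" .
    show "\<exists>n\<ge>1. real n \<le> lift F ((T ^^ n) x) * lift G ((T ^^ (2 * n)) x)"
      if x: "x \<in> (\<Union>t\<in>?C. P t)" for x
    proof -
      obtain t where t': "t \<in> ?C" "x \<in> P t" using x by blast
      then obtain n where t: "x \<in> P t" "1 \<le> n" "t + 2 * n < N" "n \<le> F (t + n) * G (t + 2 * n)"
        by blast
      have "lift F ((T ^^ n) x) = real (F (t + n))" using t by (intro lift_eq orbit) auto
      moreover have "lift G ((T ^^ (2 * n)) x) = real (G (t + 2 * n))" using t by (intro lift_eq orbit) auto
      ultimately have "real n \<le> lift F ((T ^^ n) x) * lift G ((T ^^ (2 * n)) x)"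
        using t(4) by (simp flip: of_nat_mult)
      thus ?thesis using t(2) by blast
    qed
  qed (use lift_int lift_nonneg lift_exp FG in auto)
qed

end

section \<open>Divergence\<close>

lemma (in finite_measure) L1_series:
  fixes f :: "nat \<Rightarrow> 'a \<Rightarrow> real"
  assumes f: "\<And>k. integrable M (f k)" "\<And>k x. 0 \<le> f k x"
    and s: "summable (\<lambda>k. \<integral>x. f k x \<partial>M)"
  shows "integrable M (\<lambda>x. \<Sum>k. f k x)" "AE x in M. summable (\<lambda>k. f k x)"
proof -
  have [measurable]: "f k \<in> borel_measurable M" for k using f(1)[of k] by auto
  have "(\<integral>\<^sup>+x. (\<Sum>k. ennreal (f k x)) \<partial>M) = (\<Sum>k. \<integral>\<^sup>+x. ennreal (f k x) \<partial>M)"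
    by (rule nn_integral_suminf) measurable
  also have "\<dots> = (\<Sum>k. ennreal (\<integral>x. f k x \<partial>M))"
    using f by (simp add: nn_integral_eq_integral)
  also have "\<dots> = ennreal (\<Sum>k. \<integral>x. f k x \<partial>M)"
    using f s by (intro suminf_ennreal2 integral_nonneg_AE) auto
  finally have "(\<integral>\<^sup>+x. (\<Sum>k. ennreal (f k x)) \<partial>M) \<noteq> \<infinity>" by simp
  hence "AE x in M. (\<Sum>k. ennreal (f k x)) \<noteq> \<infinity>"
    by (intro nn_integral_noteq_infinite) measurable
  thus ae: "AE x in M. summable (\<lambda>k. f k x)"
    by eventually_elim (use f(2) in \<open>auto intro: summable_suminf_not_top\<close>)
  show "integrable M (\<lambda>x. \<Sum>k. f k x)"
    using f s ae by (intro integrable_suminf) auto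
qed

theorem theorem3:
  fixes M :: "'a measure" and T :: "'a \<Rightarrow> 'a"
  assumes "prob_space M"
    and "nonatomic M"
    and "measure_preserving M T"
    and "ergodic M T"
  shows "\<exists>f g :: 'a \<Rightarrow> real. integrable M f \<and> integrable M g \<and>
    \<not> (AE x in M. convergent (\<lambda>N. furstenberg_average T f g N x))"
proof -
  interpret mp_system M T
    using assms(1,3) by (intro mp_system.intro mp_system_axioms.intro)
  define good where "good k fgD \<longleftrightarrow> (case fgD of (f, g, D) \<Rightarrow>
    integrable M f \<and> (\<forall>x. 0 \<le> f x) \<and> expectation f \<le> 32 * (1 / 4) ^ k \<and>
    integrable M g \<and> (\<forall>x. 0 \<le> g x) \<and> expectation g \<le> 32 * (1 / 4) ^ k \<and>
    D \<in> events \<and> 1 / 32 \<le> prob D \<and>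
    (\<forall>x\<in>D. \<exists>n\<ge>1. real n \<le> f ((T ^^ n) x) * g ((T ^^ (2 * n)) x)))"
    for k :: nat and fgD :: "('a \<Rightarrow> real) \<times> ('a \<Rightarrow> real) \<times> 'a set"
  have "\<exists>fgD. good k fgD" for k
  proof -
    have "0 < (1 / 4 :: real) ^ k" "(1 / 4 :: real) ^ k \<le> 1" by (auto simp: power_le_one)
    then obtain f g D where
      "integrable M f" "\<And>x. 0 \<le> f x" "expectation f \<le> 32 * (1 / 4) ^ k"
      "integrable M g" "\<And>x. 0 \<le> g x" "expectation g \<le> 32 * (1 / 4) ^ k"
      "D \<in> events" "1 / 32 \<le> prob D"
      "\<And>x. x \<in> D \<Longrightarrow> \<exists>n\<ge>1. real n \<le> f ((T ^^ n) x) * g ((T ^^ (2 * n)) x)"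
      by (rule pattern_functions[OF assms(4,2)]) (rule that; assumption)
    hence "good k (f, g, D)" by (simp add: good_def)
    thus ?thesis by blast
  qed
  then obtain h where h: "\<And>k. good k (h k)" by metis
  define f g D where "f k = fst (h k)" and "g k = fst (snd (h k))" and "D k = snd (snd (h k))" for k
  have f: "integrable M (f k)" "\<And>x. 0 \<le> f k x" "expectation (f k) \<le> 32 * (1 / 4) ^ k"
    and g: "integrable M (g k)" "\<And>x. 0 \<le> g k x" "expectation (g k) \<le> 32 * (1 / 4) ^ k"
    and D: "D k \<in> events" "1 / 32 \<le> prob (D k)"
    and hit: "\<And>x. x \<in> D k \<Longrightarrow> \<exists>n\<ge>1. real n \<le> f k ((T ^^ n) x) * g k ((T ^^ (2 * n)) x)" for k
    using h[of k] by (auto simp: good_def f_def g_def D_def case_prod_beta')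
  \<comment> \<open>The series of means is dominated by \<open>32 * 2 ^ (-k)\<close>, while the product of two \<open>k\<close>-th terms is
    \<open>4 ^ k\<close> times as large as without the factors.\<close>
  define S where "S u x = (\<Sum>k. 2 ^ k * u k x)" for u :: "nat \<Rightarrow> 'a \<Rightarrow> real" and x
  have series: "integrable M (S u) \<and> (AE x in M. summable (\<lambda>k. 2 ^ k * u k x))"
    if u: "\<And>k. integrable M (u k)" "\<And>k x. 0 \<le> u k x" "\<And>k. expectation (u k) \<le> 32 * (1 / 4) ^ k"
    for u :: "nat \<Rightarrow> 'a \<Rightarrow> real"
  proof -
    have "summable (\<lambda>k. expectation (\<lambda>x. 2 ^ k * u k x))"
    proof (rule summable_comparison_test')
      show "summable (\<lambda>k. 32 * (1 / 2 :: real) ^ k)" by (intro summable_mult summable_geometric) simp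
      fix k :: nat
      have "2 ^ k * expectation (u k) \<le> 2 ^ k * (32 * (1 / 4) ^ k)" by (intro mult_left_mono u) auto
      also have "\<dots> = 32 * (2 * (1 / 4)) ^ k" by (simp only: power_mult_distrib mult_ac)
      finally show "norm (expectation (\<lambda>x. 2 ^ k * u k x)) \<le> 32 * (1 / 2) ^ k"
        using u by (simp add: integral_nonneg_AE)
    qed
    thus ?thesis unfolding S_def using u by (intro conjI L1_series) auto
  qed
  have "\<not> (AE x in M. convergent (\<lambda>N. furstenberg_average T (S f) (S g) N x))"
  proof
    assume conv: "AE x in M. convergent (\<lambda>N. furstenberg_average T (S f) (S g) N x)"
    define V where "V m = (\<Union>k\<in>{m..}. D k)" for m
    define E where "E = (\<Inter>m. V m)"
    have V_sets: "V m \<in> events" for m unfolding V_def using D by auto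
    have "decseq V" unfolding V_def decseq_def by (intro allI impI UN_mono) auto
    hence lim: "(\<lambda>m. prob (V m)) \<longlonglongrightarrow> prob E"
      unfolding E_def using V_sets by (intro finite_Lim_measure_decseq) auto
    have "1 / 32 \<le> prob (V m)" for m
      using D[of m] V_sets by (intro order_trans[OF D(2)[of m] finite_measure_mono]) (auto simp: V_def)
    hence E: "1 / 32 \<le> prob E" by (intro LIMSEQ_le_const[OF lim]) auto
    have E_sets: "E \<in> events" unfolding E_def using V_sets by auto
    define Q where "Q x \<longleftrightarrow> convergent (\<lambda>N. furstenberg_average T (S f) (S g) N x) \<and>
      (\<forall>n. summable (\<lambda>k. 2 ^ k * f k ((T ^^ n) x))) \<and> (\<forall>n. summable (\<lambda>k. 2 ^ k * g k ((T ^^ n) x)))" for x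
    have Q: "AE x in M. Q x"
      unfolding Q_def
      using conv AE_orbit[OF conjunct2[OF series[OF f]]] AE_orbit[OF conjunct2[OF series[OF g]]]
      by eventually_elim simp
    have "\<exists>x. x \<in> E \<and> Q x"
    proof (rule ccontr)
      assume "\<not> ?thesis"
      hence "AE x in M. x \<notin> E" using Q by (auto elim: eventually_mono)
      hence "prob E = 0" using E_sets by (simp add: prob_eq_0)
      thus False using E by simp
    qed
    then obtain x where x: "x \<in> E"
      and conv_x: "convergent (\<lambda>N. furstenberg_average T (S f) (S g) N x)"
      and sf: "\<And>n. summable (\<lambda>k. 2 ^ k * f k ((T ^^ n) x))"
      and sg: "\<And>n. summable (\<lambda>k. 2 ^ k * g k ((T ^^ n) x))"
      by (auto simp: Q_def)
    obtain K where K: "\<And>N. norm (furstenberg_average T (S f) (S g) N x) \<le> K"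
      using convergent_imp_Bseq[OF conv_x] by (auto simp: Bseq_def)
    obtain m where m: "K < 4 ^ m" using real_arch_pow[of 4 K] by auto
    obtain k where k: "m \<le> k" "x \<in> D k" using x by (auto simp: E_def V_def)
    obtain n where n: "1 \<le> n" "real n \<le> f k ((T ^^ n) x) * g k ((T ^^ (2 * n)) x)"
      using hit[OF k(2)] by blast
    have Sf: "2 ^ j * f j ((T ^^ i) x) \<le> S f ((T ^^ i) x)" for i j
      unfolding S_def using sum_le_suminf[OF sf[of i], of "{j}"] f(2) by simp
    have Sg: "2 ^ j * g j ((T ^^ i) x) \<le> S g ((T ^^ i) x)" for i j
      unfolding S_def using sum_le_suminf[OF sg[of i], of "{j}"] g(2) by simp
    have Sf0: "0 \<le> S f ((T ^^ i) x)" for i using Sf[of 0 i] f(2)[of 0 "(T ^^ i) x"] by simp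
    have Sg0: "0 \<le> S g ((T ^^ i) x)" for i using Sg[of 0 i] g(2)[of 0 "(T ^^ i) x"] by simp
    have four: "(4 :: real) ^ k = 2 ^ k * 2 ^ k" by (simp flip: power_mult_distrib)
    have "4 ^ k * real n \<le> 4 ^ k * (f k ((T ^^ n) x) * g k ((T ^^ (2 * n)) x))"
      using n by (intro mult_left_mono) auto
    also have "\<dots> = (2 ^ k * f k ((T ^^ n) x)) * (2 ^ k * g k ((T ^^ (2 * n)) x))"
      by (simp only: four mult_ac)
    also have "\<dots> \<le> S f ((T ^^ n) x) * S g ((T ^^ (2 * n)) x)"
      by (intro mult_mono Sf Sg Sf0) (simp add: g)
    also have "\<dots> \<le> (\<Sum>i = 0..n. S f ((T ^^ i) x) * S g ((T ^^ (2 * i)) x))"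
      by (rule member_le_sum) (auto intro: mult_nonneg_nonneg Sf0 Sg0)
    finally have "4 ^ k \<le> furstenberg_average T (S f) (S g) n x"
      using n(1) by (simp add: furstenberg_average_def field_simps)
    moreover have "(4 :: real) ^ m \<le> 4 ^ k" using k(1) by (intro power_increasing) auto
    ultimately show False using K[of n] m unfolding real_norm_def by linarith
  qed
  thus ?thesis using series[OF f] series[OF g] by blast
qed

end
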